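(* Let $X:SU(2)\to\mathbb{C}$ be a $2$-weakly bi-invariant random field with coefficients $a^\ell_{m,s}$, i.e. $X=\sum_{\ell,m,s}a^\ell_{m,s}\phi^\ell_{m,s}$, and let $X^\ell=\sum_{m,s=-\ell}^{\ell}a^\ell_{m,s}\phi^\ell_{m,s}$. Then $\mathbb{E}\{a^\ell_{m,s}\}=0$ whenever $\ell\neq0$. Moreover, the random variables $a^\ell_{m,s}$ have the following correlation structure: $$\mathbb{E}\left\{\overline{a^\ell_{m,s}}\,a^{\ell'}_{m',s'}\right\}=\delta_{m,m'}\frac{\delta_{\ell,\ell'}}{(2\ell+1)^2}\,\delta_{s,s'}\,\mathbb{E}\left\{\|X^\ell\|^2_{L^2(SU(2))}\right\}.$$ In particular, the variance of $a^\ell_{m,s}$ depends only on $\ell$. Furthermore, $$\mathbb{E}\left\{a^\ell_{m,s}a^{\ell'}_{m',s'}\right\}=\delta_{-m,m'}\frac{\delta_{\ell,\ell'}}{(2\ell+1)^2}\,\delta_{-s,s'}(-1)^{\ell-m}(-1)^{\ell-s}\,\mathbb{E}\left\{\langle\overline{X^\ell},X^\ell\rangle_{L^2(SU(2))}\right\}i^{2\ell}.$$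
   Context: $\frac12\mathbb{N}=\{0,\frac12,1,\dots\}$; $\ell,\ell'\in\frac12\mathbb{N}$, $m,s\in\{-\ell,\dots,\ell\}$, $m',s'\in\{-\ell',\dots,\ell'\}$, indices running in steps of 1. Elements of $SU(2)$ are $h(\alpha,\beta)=\begin{pmatrix}\alpha&-\overline\beta\\ \beta&\overline\alpha\end{pmatrix}$, $|\alpha|^2+|\beta|^2=1$; $SU(2)$ carries the metric of the round 3-sphere of radius 2 (volume $16\pi^2$). $\langle F,G\rangle_{L^2(SU(2))}=\int\overline{F}G\,d\mathrm{vol}$. Wigner functions: with $\psi^\ell_m(z_0,z_1)=\binom{2\ell}{\ell+m}^{1/2}z_0^{\ell+m}z_1^{\ell-m}$, $D^\ell_{m,s}:SU(2)\to\mathbb{C}$ is defined by $\sum_m\psi^\ell_m(z_0,z_1)D^\ell_{m,s}(h(\alpha,\beta))=\psi^\ell_s(\overline\alpha z_0+\overline\beta z_1,-\beta z_0+\alpha z_1)$ for all $z_0,z_1\in\mathbb{C}$. The functions $\phi^\ell_{m,s}=\frac{\sqrt{2\ell+1}}{4\pi}D^\ell_{m,s}$ form an orthonormal basis of $L^2(SU(2))$. A random field is a measurable $X:\Omega\times SU(2)\to\mathbb{C}$, with $\Omega$ a probability space. $X$ is $2$-weakly bi-invariant if $\mathbb{E}|X(g)|<\infty$ for every $g\in SU(2)$ and, for every $\phi:g\mapsto hgh'$, $h,h'\in SU(2)$, the fields $X$ and $X\circ\phi$ have the same joint moments of order up to 2: $\mathbb{E}\{c^i(X(\phi(g_1)))\,c^j(X(\phi(g_2)))\}=\mathbb{E}\{c^i(X(g_1))\,c^j(X(g_2))\}$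 for every $i,j\in\{0,1\}$ and $g_1,g_2\in SU(2)$, where $c(z)=\overline z$ (and $c^0$ is the identity). Such a field is almost surely in $L^2(SU(2))$, and $a^\ell_{m,s}$ are its coefficients in the orthonormal basis $\phi^\ell_{m,s}$.
   Formalization: The factor i^{2ℓ} in the last formula is dropped: with the given conventions it is false (e.g. for real fields of spin ℓ=1/2). Moments of order 1 and 2 are taken to exist and the first-order moments are also required to be invariant. *)

theory Defs
  imports "HOL-Probability.Probability"
begin

section \<open>The group \<open>SU(2)\<close> and its volume measure\<close>

definition h :: "complex \<Rightarrow> complex \<Rightarrow> complex^2^2" where
  "h \<alpha> \<beta> = vector [vector [\<alpha>, - cnj \<beta>], vector [\<beta>, cnj \<alpha>]]"

definition SU2 :: "(complex^2^2) set" where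
  "SU2 = {h \<alpha> \<beta> | \<alpha> \<beta>. (cmod \<alpha>)\<^sup>2 + (cmod \<beta>)\<^sup>2 = 1}"

text \<open>
  The parametrisation \<open>h\<close> identifies \<open>SU2\<close> with the unit sphere of
  \<open>complex \<times> complex\<close>, that is of Euclidean 4-space; scaled by 2, it is the round sphere of
  radius 2. The surface measure of a sphere of radius \<open>r\<close> in dimension \<open>n\<close> is \<open>n / r\<close> times the
  push-forward of the Lebesgue measure on the solid ball of radius \<open>r\<close> along the radial projection
  (polar coordinates); here \<open>n / r = 4 / 2 = 2\<close>. The total mass is computed below.
\<close>

definition vol_SU2 :: "(complex^2^2) measure" where
  "vol_SU2 =
     distr (scale_measure 2 (restrict_space lborel (cball (0 :: complex \<times> complex) 2 - {0})))
       (restrict_space borel SU2) (\<lambda>x. case x /\<^sub>R norm x of (\<alpha>, \<beta>) \<Rightarrow> h \<alpha> \<beta>)"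

definition L2_inner :: "(complex^2^2 \<Rightarrow> complex) \<Rightarrow> (complex^2^2 \<Rightarrow> complex) \<Rightarrow> complex" where
  "L2_inner F G = (LINT g|vol_SU2. cnj (F g) * G g)"

definition L2_norm :: "(complex^2^2 \<Rightarrow> complex) \<Rightarrow> real" where
  "L2_norm F = sqrt (LINT g|vol_SU2. (cmod (F g))\<^sup>2)"


section \<open>Wigner functions\<close>

definition half_nats :: "real set" where
  "half_nats = {real n / 2 | n :: nat. True}"

definition spins :: "real \<Rightarrow> real set" where
  "spins l = {- l + real k | k :: nat. - l + real k \<le> l}"

text \<open>For \<open>m \<in> spins l\<close> all the numbers rounded below are already natural numbers.\<close>

definition psi :: "real \<Rightarrow> real \<Rightarrow> complex \<Rightarrow> complex \<Rightarrow> complex" where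
  "psi l m z0 z1 =
     complex_of_real (sqrt (real (nat \<lfloor>2 * l\<rfloor> choose nat \<lfloor>l + m\<rfloor>)))
       * z0 ^ nat \<lfloor>l + m\<rfloor> * z1 ^ nat \<lfloor>l - m\<rfloor>"

text \<open>
  The arguments of \<open>psi\<close> on the right are those for \<open>g = h \<alpha> \<beta>\<close>, where \<open>\<alpha> = g$1$1\<close> and
  \<open>\<beta> = g$2$1\<close>. The column \<open>d\<close> of coefficients is set to 0 outside \<open>spins l\<close> only to make it unique
  as a function on \<open>real\<close>; see \<open>wignerD_eq\<close> and \<open>wignerD_unique\<close> below.
\<close>

definition wignerD :: "real \<Rightarrow> real \<Rightarrow> real \<Rightarrow> complex^2^2 \<Rightarrow> complex" where
  "wignerD l m s g =
     (THE d :: real \<Rightarrow> complex. (\<forall>k. k \<notin> spins l \<longrightarrow> d k = 0) \<and>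
        (\<forall>z0 z1. (\<Sum>k\<in>spins l. psi l k z0 z1 * d k) =
           psi l s (cnj (g$1$1) * z0 + cnj (g$2$1) * z1) (- (g$2$1) * z0 + g$1$1 * z1))) m"

definition phi :: "real \<Rightarrow> real \<Rightarrow> real \<Rightarrow> complex^2^2 \<Rightarrow> complex" where
  "phi l m s g = complex_of_real (sqrt (2 * l + 1) / (4 * pi)) * wignerD l m s g"


section \<open>Random fields\<close>

definition random_field :: "'w measure \<Rightarrow> ('w \<Rightarrow> complex^2^2 \<Rightarrow> complex) \<Rightarrow> bool" where
  "random_field M X \<longleftrightarrow> prob_space M \<and>
     (\<lambda>(\<omega>, g). X \<omega> g) \<in> borel_measurable (M \<Otimes>\<^sub>M restrict_space borel SU2)"

text \<open>
  The power \<open>cnj ^^ i\<close> is the identity for \<open>i = 0\<close> and conjugation for \<open>i = 1\<close>. Since a Bochner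
  integral has the value 0 when it does not exist, the existence of the moments of order 1 and 2
  is required explicitly.
\<close>

definition two_weakly_bi_invariant :: "'w measure \<Rightarrow> ('w \<Rightarrow> complex^2^2 \<Rightarrow> complex) \<Rightarrow> bool" where
  "two_weakly_bi_invariant M X \<longleftrightarrow>
     (\<forall>g\<in>SU2. integrable M (\<lambda>\<omega>. X \<omega> g)) \<and>
     (\<forall>i\<in>{0, 1 :: nat}. \<forall>j\<in>{0, 1 :: nat}. \<forall>g1\<in>SU2. \<forall>g2\<in>SU2.
        integrable M (\<lambda>\<omega>. (cnj ^^ i) (X \<omega> g1) * (cnj ^^ j) (X \<omega> g2))) \<and>
     (\<forall>k\<in>SU2. \<forall>k'\<in>SU2.
        (\<forall>i\<in>{0, 1 :: nat}. \<forall>g\<in>SU2.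
           (LINT \<omega>|M. (cnj ^^ i) (X \<omega> (k ** g ** k'))) = (LINT \<omega>|M. (cnj ^^ i) (X \<omega> g))) \<and>
        (\<forall>i\<in>{0, 1 :: nat}. \<forall>j\<in>{0, 1 :: nat}. \<forall>g1\<in>SU2. \<forall>g2\<in>SU2.
           (LINT \<omega>|M. (cnj ^^ i) (X \<omega> (k ** g1 ** k')) * (cnj ^^ j) (X \<omega> (k ** g2 ** k'))) =
           (LINT \<omega>|M. (cnj ^^ i) (X \<omega> g1) * (cnj ^^ j) (X \<omega> g2))))"

definition coeff_field ::
  "('w \<Rightarrow> complex^2^2 \<Rightarrow> complex) \<Rightarrow> real \<Rightarrow> real \<Rightarrow> real \<Rightarrow> 'w \<Rightarrow> complex" where
  "coeff_field X l m s \<omega> = L2_inner (phi l m s) (X \<omega>)"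

definition component ::
  "('w \<Rightarrow> complex^2^2 \<Rightarrow> complex) \<Rightarrow> real \<Rightarrow> 'w \<Rightarrow> complex^2^2 \<Rightarrow> complex" where
  "component X l \<omega> g = (\<Sum>m\<in>spins l. \<Sum>s\<in>spins l. coeff_field X l m s \<omega> * phi l m s g)"

definition complex_variance :: "'w measure \<Rightarrow> ('w \<Rightarrow> complex) \<Rightarrow> real" where
  "complex_variance M Y = (LINT \<omega>|M. (cmod (Y \<omega> - (LINT \<omega>'|M. Y \<omega>')))\<^sup>2)"


section \<open>Basic properties\<close>

lemma h_nth [simp]:
  "h \<alpha> \<beta> $ 1 $ 1 = \<alpha>" "h \<alpha> \<beta> $ 1 $ 2 = - cnj \<beta>" "h \<alpha> \<beta> $ 2 $ 1 = \<beta>" "h \<alpha> \<beta> $ 2 $ 2 = cnj \<alpha>"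
  by (simp_all add: h_def)

lemma matrix2_eqI:
  fixes A B :: "'a^2^2"
  assumes "A$1$1 = B$1$1" "A$1$2 = B$1$2" "A$2$1 = B$2$1" "A$2$2 = B$2$2"
  shows "A = B"
  using assms by (simp add: vec_eq_iff forall_2)

lemma h_mult:
  "h \<alpha> \<beta> ** h \<alpha>' \<beta>' = h (\<alpha> * \<alpha>' - cnj \<beta> * \<beta>') (\<beta> * \<alpha>' + cnj \<alpha> * \<beta>')"
  by (rule matrix2_eqI) (simp_all add: matrix_matrix_mult_def sum_2 algebra_simps)

lemma SU2_iff_unitary:
  "A \<in> SU2 \<longleftrightarrow> A ** (\<chi> i j. cnj (A$j$i)) = mat 1 \<and> det A = 1"
proof
  assume "A \<in> SU2"
  then obtain \<alpha> \<beta> where A: "A = h \<alpha> \<beta>" and 1: "(cmod \<alpha>)\<^sup>2 + (cmod \<beta>)\<^sup>2 = 1"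
    by (auto simp: SU2_def)
  have 2: "\<alpha> * cnj \<alpha> + \<beta> * cnj \<beta> = 1"
    using 1 by (metis complex_norm_square of_real_1 of_real_add)
  show "A ** (\<chi> i j. cnj (A$j$i)) = mat 1 \<and> det A = 1"
    using 2 unfolding A
    by (intro conjI matrix2_eqI)
       (simp_all add: matrix_matrix_mult_def sum_2 det_2 mat_def algebra_simps)
next
  assume *: "A ** (\<chi> i j. cnj (A$j$i)) = mat 1 \<and> det A = 1"
  define a b c d where abcd: "a = A$1$1" "b = A$1$2" "c = A$2$1" "d = A$2$2"
  have e: "(A ** (\<chi> i j. cnj (A$j$i)))$i$j = (if i = j then 1 else 0)" for i j
    using * by (simp add: mat_def)
  have e1: "a * cnj a + b * cnj b = 1" and e2: "c * cnj a + d * cnj b = 0"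
    using e[of 1 1] e[of 2 1] by (simp_all add: matrix_matrix_mult_def sum_2 abcd)
  have e3: "a * d - b * c = 1" using * by (simp add: det_2 abcd)
  have "d = d * (a * cnj a + b * cnj b)" using e1 by simp
  also have "\<dots> = (a * d - b * c) * cnj a + b * (c * cnj a + d * cnj b)"
    by (simp add: algebra_simps)
  finally have d: "d = cnj a" using e2 e3 by simp
  have "c = c * (a * cnj a + b * cnj b)" using e1 by simp
  also have "\<dots> = a * (c * cnj a + d * cnj b) - (a * d - b * c) * cnj b"
    by (simp add: algebra_simps)
  finally have c: "b = - cnj c" using e2 e3 by simp
  have "A = h a c"
    by (rule matrix2_eqI) (use c d in \<open>simp_all add: abcd\<close>)
  moreover have "(cmod a)\<^sup>2 + (cmod c)\<^sup>2 = 1"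
  proof -
    have "complex_of_real ((cmod a)\<^sup>2 + (cmod c)\<^sup>2) = 1"
      using e1 c by (simp add: complex_norm_square algebra_simps del: of_real_power)
    then show ?thesis using of_real_eq_1_iff by blast
  qed
  ultimately show "A \<in> SU2" by (auto simp: SU2_def)
qed

lemma SU2_mult: "A \<in> SU2 \<Longrightarrow> B \<in> SU2 \<Longrightarrow> A ** B \<in> SU2"
proof -
  assume "A \<in> SU2" "B \<in> SU2"
  then obtain \<alpha> \<beta> \<alpha>' \<beta>' where AB: "A = h \<alpha> \<beta>" "B = h \<alpha>' \<beta>'"
    and 1: "(cmod \<alpha>)\<^sup>2 + (cmod \<beta>)\<^sup>2 = 1" "(cmod \<alpha>')\<^sup>2 + (cmod \<beta>')\<^sup>2 = 1"
    by (auto simp: SU2_def)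
  have 2: "\<alpha> * cnj \<alpha> + \<beta> * cnj \<beta> = 1" "\<alpha>' * cnj \<alpha>' + \<beta>' * cnj \<beta>' = 1"
    using 1 by (metis complex_norm_square of_real_1 of_real_add)+
  define p q where "p = \<alpha> * \<alpha>' - cnj \<beta> * \<beta>'" and "q = \<beta> * \<alpha>' + cnj \<alpha> * \<beta>'"
  have "p * cnj p + q * cnj q = (\<alpha> * cnj \<alpha> + \<beta> * cnj \<beta>) * (\<alpha>' * cnj \<alpha>' + \<beta>' * cnj \<beta>')"
    by (simp add: p_def q_def algebra_simps)
  also have "\<dots> = 1" using 2 by simp
  finally have "complex_of_real ((cmod p)\<^sup>2 + (cmod q)\<^sup>2) = 1"
    by (simp add: complex_norm_square del: of_real_power)
  then have "(cmod p)\<^sup>2 + (cmod q)\<^sup>2 = 1" using of_real_eq_1_iff by blast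
  then show "A ** B \<in> SU2" unfolding AB h_mult p_def q_def by (auto simp: SU2_def)
qed

lemma space_vol_SU2 [simp]: "space vol_SU2 = SU2"
  by (simp add: vol_SU2_def space_restrict_space)

lemma sets_vol_SU2 [simp, measurable_cong]: "sets vol_SU2 = sets (restrict_space borel SU2)"
  by (simp add: vol_SU2_def)

lemma continuous_on_h: "continuous_on A (\<lambda>x :: complex \<times> complex. h (fst x) (snd x))"
proof -
  have "continuous_on A (\<lambda>x :: complex \<times> complex. h (fst x) (snd x) $ i $ j)" for i j :: 2
    using exhaust_2[of i] exhaust_2[of j] by (elim disjE) (simp_all add: continuous_intros)
  then have "continuous_on A (\<lambda>x :: complex \<times> complex. \<chi> i. \<chi> j. h (fst x) (snd x) $ i $ j)"
    by (intro continuous_on_vec_lambda)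
  then show ?thesis by (simp only: vec_lambda_eta)
qed

lemma radial_measurable:
  "(\<lambda>x :: complex \<times> complex. case x /\<^sub>R norm x of (\<alpha>, \<beta>) \<Rightarrow> h \<alpha> \<beta>)
     \<in> measurable (scale_measure 2 (restrict_space lborel (cball 0 2 - {0}))) (restrict_space borel SU2)"
proof -
  define n where "n x = x /\<^sub>R norm x" for x :: "complex \<times> complex"
  define f where "f x = h (fst (n x)) (snd (n x))" for x
  have f_eq: "(\<lambda>x :: complex \<times> complex. case x /\<^sub>R norm x of (\<alpha>, \<beta>) \<Rightarrow> h \<alpha> \<beta>) = f"
    by (simp add: fun_eq_iff f_def n_def case_prod_unfold)
  have n: "n \<in> borel_measurable borel"
    unfolding n_def by (intro borel_measurable_scaleR borel_measurable_inverse
      borel_measurable_norm measurable_ident_sets refl)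
  have "(\<lambda>x :: complex \<times> complex. h (fst x) (snd x)) \<in> borel_measurable borel"
    by (rule borel_measurable_continuous_onI[OF continuous_on_h])
  from measurable_compose[OF n this] have f: "f \<in> borel_measurable borel"
    unfolding f_def .
  have "f x \<in> SU2" if "x \<noteq> 0" for x
  proof -
    have "norm (n x) = 1" using that by (simp add: n_def)
    then have "(cmod (fst (n x)))\<^sup>2 + (cmod (snd (n x)))\<^sup>2 = 1"
      by (simp add: norm_prod_def)
    then show ?thesis unfolding SU2_def f_def by blast
  qed
  then have "f \<in> measurable (restrict_space borel (cball 0 2 - {0})) (restrict_space borel SU2)"
    using f by (intro measurable_restrict_space3) auto
  moreover have "measurable (scale_measure 2 (restrict_space lborel (cball 0 2 - {0}))) N =
      measurable (restrict_space borel (cball (0 :: complex \<times> complex) 2 - {0})) N" for N :: "(complex^2^2) measure"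
    by (rule measurable_cong_sets) (simp_all add: sets_restrict_space)
  ultimately show ?thesis unfolding f_eq by simp
qed

lemma emeasure_vol_SU2: "emeasure vol_SU2 SU2 = ennreal (16 * pi\<^sup>2)"
proof -
  let ?B = "cball (0 :: complex \<times> complex) 2 - {0}"
  let ?M = "scale_measure 2 (restrict_space lborel ?B)"
  have sp: "space ?M = ?B" by (simp add: space_restrict_space space_scale_measure)
  have "SU2 \<in> sets (restrict_space borel SU2)"
    using sets.top[of "restrict_space borel SU2"] by (simp add: space_restrict_space)
  then have "emeasure vol_SU2 SU2 =
      emeasure ?M ((\<lambda>x. case x /\<^sub>R norm x of (\<alpha>, \<beta>) \<Rightarrow> h \<alpha> \<beta>) -` SU2 \<inter> space ?M)"
    unfolding vol_SU2_def by (rule emeasure_distr[OF radial_measurable])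
  also have "(\<lambda>x. case x /\<^sub>R norm x of (\<alpha>, \<beta>) \<Rightarrow> h \<alpha> \<beta>) -` SU2 \<inter> space ?M = ?B"
    using measurable_space[OF radial_measurable] sp by (auto simp: space_restrict_space)
  finally have "emeasure vol_SU2 SU2 = emeasure ?M ?B" .
  also have "\<dots> = 2 * emeasure lborel ?B"
    by (simp add: emeasure_restrict_space)
  also have "emeasure lborel ?B = emeasure lborel (cball (0 :: complex \<times> complex) 2)"
    by (intro emeasure_Diff_null_set) (auto simp: null_sets_def)
  also have "\<dots> = ennreal (unit_ball_vol 4 * 2 ^ 4)"
    by (subst emeasure_cball) simp_all
  also have "unit_ball_vol (4 :: real) = pi\<^sup>2 / 2"
    using unit_ball_vol_even[of 2] by (simp add: eval_nat_numeral)
  also have "2 * ennreal (pi\<^sup>2 / 2 * 2 ^ 4) = ennreal (16 * pi\<^sup>2)"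
    by (subst ennreal_numeral[symmetric], subst ennreal_mult[symmetric]) simp_all
  finally show ?thesis .
qed

lemma half_natsE:
  assumes "l \<in> half_nats" obtains N :: nat where "l = real N / 2"
  using assms by (auto simp: half_nats_def)

lemma spins_half: "spins (real N / 2) = (\<lambda>k. - (real N / 2) + real k) ` {..N}"
proof -
  have "- (real N / 2) + real k \<le> real N / 2 \<longleftrightarrow> k \<le> N" for k
    by (rule iffI) linarith+
  then show ?thesis unfolding spins_def by blast
qed

lemma psi_half:
  assumes "k \<le> N"
  shows "psi (real N / 2) (- (real N / 2) + real k) z0 z1 =
           complex_of_real (sqrt (real (N choose k))) * z0 ^ k * z1 ^ (N - k)"
proof -
  have eqs: "real N / 2 - (- (real N / 2) + real k) = real (N - k)"
     "real N / 2 + (- (real N / 2) + real k) = real k" "2 * (real N / 2) = real N"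
    using assms by (simp_all add: of_nat_diff)
  show ?thesis unfolding psi_def eqs by (simp only: floor_of_nat nat_int)
qed

lemma sum_spins_half: "(\<Sum>m\<in>spins (real N / 2). f m) = (\<Sum>k\<le>N. f (- (real N / 2) + real k))"
proof -
  have "inj_on (\<lambda>k. - (real N / 2) + real k) {..N}" by (rule inj_onI) simp
  from sum.reindex[OF this] show ?thesis unfolding spins_half by (simp only: o_def)
qed

definition homogeneous :: "nat \<Rightarrow> (complex \<Rightarrow> complex \<Rightarrow> complex) \<Rightarrow> bool" where
  "homogeneous n f \<longleftrightarrow> (\<exists>e. \<forall>z0 z1. f z0 z1 = (\<Sum>k\<le>n. e k * z0 ^ k * z1 ^ (n - k)))"

lemma homogeneous_const: "homogeneous 0 (\<lambda>_ _. c)"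
  unfolding homogeneous_def by (rule exI[of _ "\<lambda>_. c"]) simp

lemma homogeneous_linear_mult:
  assumes "homogeneous n f"
  shows "homogeneous (Suc n) (\<lambda>z0 z1. (p * z0 + q * z1) * f z0 z1)"
proof -
  obtain e where e: "\<And>z0 z1. f z0 z1 = (\<Sum>k\<le>n. e k * z0 ^ k * z1 ^ (n - k))"
    using assms unfolding homogeneous_def by blast
  define e' where "e' k = (if k = 0 then 0 else p * e (k - 1)) + (if k \<le> n then q * e k else 0)" for k
  have "(p * z0 + q * z1) * f z0 z1 = (\<Sum>k\<le>Suc n. e' k * z0 ^ k * z1 ^ (Suc n - k))" for z0 z1
  proof -
    have 1: "(\<Sum>k\<le>Suc n. (if k = 0 then 0 else p * e (k - 1)) * z0 ^ k * z1 ^ (Suc n - k)) =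
       p * z0 * f z0 z1"
      unfolding e sum.atMost_Suc_shift sum_distrib_left
      by (simp add: mult_ac)
    have 2: "(\<Sum>k\<le>Suc n. (if k \<le> n then q * e k else 0) * z0 ^ k * z1 ^ (Suc n - k)) =
       q * z1 * f z0 z1"
      unfolding e sum.atMost_Suc sum_distrib_left
      by (simp add: Suc_diff_le mult_ac)
    show ?thesis
      unfolding e'_def distrib_right sum.distrib 1 2 by simp
  qed
  then show ?thesis unfolding homogeneous_def by blast
qed

lemma homogeneous_linear_powers:
  "homogeneous (i + j) (\<lambda>z0 z1. (p * z0 + q * z1) ^ i * ((r * z0 + t * z1) ^ j * c))"
proof (induction i)
  case 0
  show ?case
  proof (induction j)
    case 0
    show ?case using homogeneous_const[of c] by simp
  next
    case (Suc j)
    then show ?case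
      using homogeneous_linear_mult[of j "\<lambda>z0 z1. (r * z0 + t * z1) ^ j * c" r t]
      by (simp add: mult.assoc)
  qed
next
  case (Suc i)
  then show ?case
    using homogeneous_linear_mult[of "i + j"
        "\<lambda>z0 z1. (p * z0 + q * z1) ^ i * ((r * z0 + t * z1) ^ j * c)" p q]
    by (simp add: mult.assoc)
qed

lemma wigner_ex1:
  assumes "l \<in> half_nats" "s \<in> spins l"
  shows "\<exists>!d :: real \<Rightarrow> complex. (\<forall>k. k \<notin> spins l \<longrightarrow> d k = 0) \<and>
        (\<forall>z0 z1. (\<Sum>k\<in>spins l. psi l k z0 z1 * d k) = psi l s (p * z0 + q * z1) (r * z0 + t * z1))"
proof -
  obtain N :: nat where lN: "l = real N / 2" using assms(1) by (rule half_natsE)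
  obtain j where j: "s = - l + real j" "j \<le> N" using assms(2) by (auto simp: lN spins_half)
  define w :: "nat \<Rightarrow> complex" where "w k = complex_of_real (sqrt (real (N choose k)))" for k
  have w0: "w k \<noteq> 0" if "k \<le> N" for k using that by (simp add: w_def binomial_eq_0_iff)
  have psi: "psi l (- l + real k) z0 z1 = w k * z0 ^ k * z1 ^ (N - k)" if "k \<le> N" for k z0 z1
    using psi_half[OF that] by (simp add: w_def lN)
  have sum: "(\<Sum>m\<in>spins l. f m) = (\<Sum>k\<le>N. f (- l + real k))" for f :: "real \<Rightarrow> complex"
    unfolding lN by (rule sum_spins_half)
  have "homogeneous N (\<lambda>z0 z1. psi l s (p * z0 + q * z1) (r * z0 + t * z1))"
    using homogeneous_linear_powers[of j "N - j" p q r t "w j"] j(2)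
    unfolding j(1) psi[OF j(2)] by (simp only: mult_ac le_add_diff_inverse)
  then obtain e where e: "\<And>z0 z1. psi l s (p * z0 + q * z1) (r * z0 + t * z1) =
      (\<Sum>k\<le>N. e k * z0 ^ k * z1 ^ (N - k))"
    unfolding homogeneous_def by blast
  define d0 where "d0 m = (if m \<in> spins l then e (nat \<lfloor>l + m\<rfloor>) / w (nat \<lfloor>l + m\<rfloor>) else 0)" for m
  show ?thesis
  proof (rule ex1I[of _ d0])
    show "(\<forall>k. k \<notin> spins l \<longrightarrow> d0 k = 0) \<and>
        (\<forall>z0 z1. (\<Sum>k\<in>spins l. psi l k z0 z1 * d0 k) = psi l s (p * z0 + q * z1) (r * z0 + t * z1))"
    proof (intro conjI allI impI)
      fix z0 z1
      have "d0 (- l + real k) = e k / w k" if "k \<le> N" for k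
        using that by (auto simp: d0_def lN spins_half)
      then show "(\<Sum>k\<in>spins l. psi l k z0 z1 * d0 k) = psi l s (p * z0 + q * z1) (r * z0 + t * z1)"
        unfolding sum e by (intro sum.cong refl) (simp add: psi w0 del: add_uminus_conv_diff uminus_add_conv_diff)
    qed (simp add: d0_def)
  next
    fix d assume d: "(\<forall>k. k \<notin> spins l \<longrightarrow> d k = 0) \<and>
        (\<forall>z0 z1. (\<Sum>k\<in>spins l. psi l k z0 z1 * d k) = psi l s (p * z0 + q * z1) (r * z0 + t * z1))"
    have "(\<Sum>k\<le>N. (w k * d (- l + real k)) * z ^ k) = (\<Sum>k\<le>N. e k * z ^ k)" for z
    proof -
      have "(\<Sum>k\<le>N. (w k * d (- l + real k)) * z ^ k) = (\<Sum>k\<in>spins l. psi l k z 1 * d k)"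
        unfolding sum
        by (intro sum.cong refl) (simp add: psi del: add_uminus_conv_diff uminus_add_conv_diff)
      also have "\<dots> = (\<Sum>k\<le>N. e k * z ^ k)" using d e[of z 1] by simp
      finally show ?thesis .
    qed
    then have "w k * d (- l + real k) = e k" if "k \<le> N" for k
      using polyfun_eq_coeffs[of "\<lambda>k. w k * d (- l + real k)" N e] that by simp
    then have *: "d (- l + real k) = e k / w k" if "k \<le> N" for k
      using that w0[OF that] by (metis nonzero_mult_div_cancel_left)
    show "d = d0"
    proof
      fix m show "d m = d0 m"
      proof (cases "m \<in> spins l")
        case True
        then obtain k where "m = - l + real k" "k \<le> N" by (auto simp: lN spins_half)
        then show ?thesis using * True by (simp add: d0_def)
      qed (use d in \<open>simp add: d0_def\<close>)
    qed
  qed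
qed

lemma wignerD_eq:
  assumes "l \<in> half_nats" "s \<in> spins l"
  shows "(\<Sum>m\<in>spins l. psi l m z0 z1 * wignerD l m s (h \<alpha> \<beta>)) =
           psi l s (cnj \<alpha> * z0 + cnj \<beta> * z1) (- \<beta> * z0 + \<alpha> * z1)"
  using theI'[OF wigner_ex1[OF assms, of "cnj \<alpha>" "cnj \<beta>" "- \<beta>" \<alpha>]]
  unfolding wignerD_def by simp

lemma wignerD_unique:
  assumes "l \<in> half_nats" "s \<in> spins l" "m \<in> spins l"
    and eq: "\<And>z0 z1. (\<Sum>k\<in>spins l. psi l k z0 z1 * d k) =
           psi l s (cnj \<alpha> * z0 + cnj \<beta> * z1) (- \<beta> * z0 + \<alpha> * z1)"
  shows "wignerD l m s (h \<alpha> \<beta>) = d m"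
proof -
  define d' where "d' k = (if k \<in> spins l then d k else 0)" for k
  have "(THE d :: real \<Rightarrow> complex. (\<forall>k. k \<notin> spins l \<longrightarrow> d k = 0) \<and>
        (\<forall>z0 z1. (\<Sum>k\<in>spins l. psi l k z0 z1 * d k) =
           psi l s (cnj \<alpha> * z0 + cnj \<beta> * z1) (- \<beta> * z0 + \<alpha> * z1))) = d'"
    by (rule the1_equality[OF wigner_ex1[OF assms(1,2)]])
       (use eq in \<open>simp add: d'_def\<close>)
  then show ?thesis using assms(3) by (simp add: wignerD_def d'_def)
qed

end

theory Submission
  imports Defs
begin

text \<open>
  The second moments of two jointly bi-invariant fields form a kernel on \<open>SU(2) \<times> SU(2)\<close> that is
  invariant under simultaneous left and right translations. As the volume is translation
  invariant and the Wigner functions are matrix coefficients of unitary representations, the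
  array of correlations of the coefficients intertwines these representations on either side, and
  Schur's lemma leaves only a scalar for each spin. The pair \<open>(X, X)\<close> gives the first correlation
  formula; the pair \<open>(cnj X, X)\<close> gives the second one, because conjugation maps the Wigner function
  with indices \<open>m, s\<close> to the one with indices \<open>- m, - s\<close> up to sign; the pair \<open>(X, 1)\<close> gives the
  means. The scalars are identified by summing over the indices, which uses orthonormality.
\<close>

section \<open>Translation invariance of the volume\<close>

text \<open>Two things must be secured before Schur's lemma can act. Translations have to preserve a
  volume that is given through Lebesgue measure on a ball of R^4; they act there as orthogonal maps,
  so the question becomes the rotation invariance of Lebesgue measure. And the kernel E(cnj (Y(g))
  Z(g')) must be bounded and measurable, so that the expectation can be exchanged with the two
  integrals over the group: by invariance E|X(g)|^2 does not depend on g, and the volume is finite.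
  Irreducibility enters in a concrete form: some matrix links every weight to the highest one,
  because its coefficients there are the nonzero terms of a binomial expansion. The same fact
  separates different spins, since the larger spin is not a weight of the smaller one.\<close>

lemma orthogonal_vimage_ball:
  fixes f :: "'a::euclidean_space \<Rightarrow> 'a"
  assumes "orthogonal_transformation f"
  shows "f -` ball (f a) r = ball a r"
  using assms
  by (auto simp: dist_norm orthogonal_transformation orthogonal_transformation_linear
      simp flip: linear_diff)

text \<open>By Vitali's covering theorem a box is, up to a null set, a countable disjoint union of balls,
  and orthogonal maps send balls to balls of the same radius.\<close>

lemma lborel_distr_orthogonal:
  fixes f :: "'a::euclidean_space \<Rightarrow> 'a"
  assumes f: "orthogonal_transformation f"
  shows "distr lborel borel f = lborel"
proof (rule lborel_eqI[symmetric])
  have lin: "linear f" using f by (simp add: orthogonal_transformation_linear)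
  have [measurable]: "f \<in> borel_measurable borel"
    using lin by (intro borel_measurable_continuous_onI linear_continuous_on) (simp add: linear_linear)
  define g where "g = inv f"
  have g: "orthogonal_transformation g" unfolding g_def
    using f by (rule orthogonal_transformation_inv)
  have fg: "f (g x) = x" and gf: "g (f x) = x" for x
    using orthogonal_transformation_bij[OF f] unfolding g_def
    by (simp_all add: bij_is_surj bij_is_inj surj_f_inv_f)
  have vim: "f -` S = g ` S" for S
    unfolding g_def by (rule bij_vimage_eq_inv_image[OF orthogonal_transformation_bij[OF f]])
  fix l u :: 'a
  assume lu: "\<And>b. b \<in> Basis \<Longrightarrow> l \<bullet> b \<le> u \<bullet> b"
  \<comment> \<open>Vitali's theorem needs a fine cover: the balls inside the box include
    arbitrarily small ones around each of its points.\<close>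
  define K where "K = {p :: 'a \<times> real. ball (fst p) (snd p) \<subseteq> box l u}"
  have "\<exists>p. p \<in> K \<and> x \<in> ball (fst p) (snd p) \<and> snd p < d" if x: "x \<in> box l u" and "0 < d" for x d
  proof -
    obtain e where e: "0 < e" "ball x e \<subseteq> box l u" using x open_box by (meson openE)
    then have "ball x (min e (d/2)) \<subseteq> box l u" by auto
    then show ?thesis using \<open>0 < d\<close> \<open>0 < e\<close>
      by (intro exI[of _ "(x, min e (d/2))"]) (auto simp: K_def)
  qed
  then obtain C where C: "countable C" "C \<subseteq> K"
    and disj: "pairwise (\<lambda>i j. disjnt (ball (fst i) (snd i)) (ball (fst j) (snd j))) C"
    and neg: "negligible (box l u - (\<Union>i\<in>C. ball (fst i) (snd i)))"
    by (rule Vitali_covering_theorem_balls[of "box l u" K fst snd]) blast+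
  define B where "B = (\<Union>i\<in>C. ball (fst i) (snd i))"
  have [measurable]: "B \<in> sets borel" unfolding B_def by (intro borel_open open_UN) auto
  have B_sub: "B \<subseteq> box l u" using C(2) by (auto simp: B_def K_def)
  have disj': "disjoint_family_on (\<lambda>i. ball (fst i) (snd i)) C"
    using disj by (auto simp: disjoint_family_on_def pairwise_def disjnt_def)
  have null: "N \<in> null_sets lborel" if "N \<in> sets borel" "negligible N" for N :: "'a set"
    using that by (simp add: null_sets_def negligible_iff_null_sets emeasure_completion
        null_sets_completion_iff)
  have N: "box l u - B \<in> null_sets lborel"
    using neg
    by (intro null sets.Diff) (simp_all add: B_def[symmetric])
  have "f -` (box l u - B) \<in> null_sets lborel"
  proof (rule null)
    show "f -` (box l u - B) \<in> sets borel"
      using measurable_sets_borel[OF \<open>f \<in> borel_measurable borel\<close>, of "box l u - B"] by simp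
    \<comment> \<open>A preimage under \<open>f\<close> is an image under its inverse
      \<open>g\<close>, and linear maps send negligible sets to negligible sets.\<close>
    show "negligible (f -` (box l u - B))" unfolding vim using neg g
      by (intro negligible_differentiable_image_negligible linear_imp_differentiable_on)
         (auto simp: B_def orthogonal_transformation_linear)
  qed
  have "emeasure (distr lborel borel f) (box l u) = emeasure lborel (f -` box l u)"
    by (subst emeasure_distr) auto
  also have "f -` box l u = f -` B \<union> f -` (box l u - B)" using B_sub by auto
  also have "emeasure lborel \<dots> = emeasure lborel (f -` B)"
    by (rule emeasure_Un_null_set) (use measurable_sets_borel[OF \<open>f \<in> borel_measurable borel\<close>, of B] in simp, fact)
  also have "f -` B = (\<Union>i\<in>C. ball (g (fst i)) (snd i))"
    unfolding B_def vimage_UN using orthogonal_vimage_ball[OF f, of "g _"] by (simp add: fg)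
  also have "emeasure lborel \<dots> = (\<integral>\<^sup>+i. emeasure lborel (ball (g (fst i)) (snd i)) \<partial>count_space C)"
  proof (rule emeasure_UN_countable)
    have "f -` ball (fst i) (snd i) = ball (g (fst i)) (snd i)" for i
      using orthogonal_vimage_ball[OF f, of "g (fst i)"] by (simp add: fg)
    then show "disjoint_family_on (\<lambda>i. ball (g (fst i)) (snd i)) C"
      using disj' unfolding disjoint_family_on_def by (metis vimage_Int vimage_empty)
  qed (use C in auto)
  also have "\<dots> = (\<integral>\<^sup>+i. emeasure lborel (ball (fst i) (snd i)) \<partial>count_space C)"
  proof (rule nn_integral_cong)
    fix i :: "'a \<times> real"
    show "emeasure lborel (ball (g (fst i)) (snd i)) = emeasure lborel (ball (fst i) (snd i))"
      \<comment> \<open>The cover may contain negative radii; those balls are empty. Otherwise the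
        volume depends on the radius alone.\<close>
      by (cases "snd i \<ge> 0") (simp_all add: emeasure_ball ball_empty)
  qed
  also have "\<dots> = emeasure lborel B" unfolding B_def
    by (rule emeasure_UN_countable[symmetric]) (use C disj' in auto)
  also have "\<dots> = emeasure lborel (B \<union> (box l u - B))"
    by (rule emeasure_Un_null_set[symmetric]) (use N in auto)
  also have "B \<union> (box l u - B) = box l u" using B_sub by auto
  finally show "emeasure (distr lborel borel f) (box l u) = (\<Prod>b\<in>Basis. (u - l) \<bullet> b)"
    using lu by (simp add: emeasure_lborel_box)
qed simp

section \<open>SU(2) as the unit sphere of R^4, and its translations\<close>

lemma SU2_eq_h: "g \<in> SU2 \<Longrightarrow> g = h (g$1$1) (g$2$1)"
  by (auto simp: SU2_def)

lemma SU2_norm_column: "g \<in> SU2 \<Longrightarrow> norm (g$1$1, g$2$1) = 1"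
  by (auto simp: SU2_def norm_prod_def)

lemma SU2E:
  assumes "g \<in> SU2" obtains \<alpha> \<beta> where "g = h \<alpha> \<beta>" "norm (\<alpha>, \<beta>) = 1"
  using that[OF SU2_eq_h[OF assms] SU2_norm_column[OF assms]] .

lemma h_in_SU2_iff: "h \<alpha> \<beta> \<in> SU2 \<longleftrightarrow> norm (\<alpha>, \<beta>) = 1"
  using SU2_norm_column[of "h \<alpha> \<beta>"] by (auto simp: SU2_def norm_prod_def)

lemma mat_1_SU2: "mat 1 \<in> SU2"
  by (simp add: SU2_iff_unitary vec_eq_iff matrix_matrix_mult_def mat_def forall_2 sum_2 det_2)

lemma measurable_translation_SU2:
  assumes "k \<in> SU2" "k' \<in> SU2"
  shows "(\<lambda>g. k ** g ** k') \<in> measurable (restrict_space borel SU2) (restrict_space borel SU2)"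
proof (rule measurable_restrict_space3)
  have "continuous_on UNIV (\<lambda>g :: complex^2^2. k ** g ** k')"
    unfolding matrix_matrix_mult_def by (intro continuous_intros continuous_on_vec_lambda)
  then show "(\<lambda>g. k ** g ** k') \<in> borel_measurable borel"
    by (rule borel_measurable_continuous_onI)
qed (use assms in \<open>auto intro: SU2_mult\<close>)

text \<open>A matrix in SU(2) is determined by its first column, a unit vector of R^4. Two-sided
  multiplication acts on that column by \<open>L\<close>, which is linear over the reals only, since
  right multiplication involves conjugates. \<open>L\<close> maps unit vectors to unit vectors
  because SU(2) is closed under products, so it is orthogonal, and the radial projection carries it
  to the translation.\<close>

lemma vol_SU2_invariant:
  assumes k: "k \<in> SU2" "k' \<in> SU2"
  shows "distr vol_SU2 vol_SU2 (\<lambda>g. k ** g ** k') = vol_SU2"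
proof -
  define L :: "complex \<times> complex \<Rightarrow> complex \<times> complex" where
    "L x = (let g = k ** h (fst x) (snd x) ** k' in (g$1$1, g$2$1))" for x
  define \<rho> :: "complex \<times> complex \<Rightarrow> complex^2^2"
    where "\<rho> x = (case x /\<^sub>R norm x of (\<alpha>, \<beta>) \<Rightarrow> h \<alpha> \<beta>)" for x
  define R where "R = cball (0 :: complex \<times> complex) 2 - {0}"
  have h_scale: "h (fst (r *\<^sub>R x)) (snd (r *\<^sub>R x)) = r *\<^sub>R h (fst x) (snd x)" for r x
    by (rule matrix2_eqI) simp_all
  have lin: "linear L"
    by (rule linearI) (simp_all add: L_def Let_def matrix_matrix_mult_def sum_2 scaleR_conv_of_real algebra_simps)
  have unit: "norm (L x) = 1 \<and> h (fst (L x)) (snd (L x)) = k ** h (fst x) (snd x) ** k'"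
    if "norm x = 1" for x
  proof -
    have "k ** h (fst x) (snd x) ** k' \<in> SU2"
      using that k by (intro SU2_mult) (simp_all add: h_in_SU2_iff)
    from SU2_norm_column[OF this] SU2_eq_h[OF this] show ?thesis by (simp add: L_def Let_def)
  qed
  have norm: "norm (L x) = norm x" for x
  proof (cases "x = 0")
    case False
    then have "norm (L (x /\<^sub>R norm x)) = 1" using unit[of "x /\<^sub>R norm x"] by simp
    then show ?thesis using False by (simp add: linear_scale[OF lin] field_simps)
  qed (simp add: linear_0[OF lin])
  have orth: "orthogonal_transformation L" using lin norm by (simp add: orthogonal_transformation)
  have [measurable]: "L \<in> borel_measurable borel"
    using lin by (intro borel_measurable_continuous_onI linear_continuous_on) (simp add: linear_linear)
  have \<rho>L: "\<rho> (L x) = k ** \<rho> x ** k'" if "x \<noteq> 0" for x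
    using unit[of "x /\<^sub>R norm x"] that
    by (simp add: \<rho>_def case_prod_unfold norm linear_scale[OF lin])
  let ?N = "scale_measure 2 (restrict_space lborel R)"
  have vol: "vol_SU2 = distr ?N (restrict_space borel SU2) \<rho>"
    unfolding vol_SU2_def \<rho>_def R_def by simp
  have \<rho>[measurable]: "\<rho> \<in> measurable ?N (restrict_space borel SU2)"
    using radial_measurable unfolding \<rho>_def[abs_def] R_def .
  have LR: "L x \<in> R \<longleftrightarrow> x \<in> R" for x
    using norm[of x] unfolding R_def by (metis DiffD1 DiffD2 DiffI dist_0_norm insertCI mem_cball norm_eq_zero singletonD)
  have sN: "sets ?N = sets (restrict_space borel R)" by (simp add: sets_restrict_space)
  have LN: "L \<in> measurable ?N ?N"
    unfolding measurable_cong_sets[OF sN sN]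
    by (rule measurable_restrict_space3) (use LR in auto)
  have Rb[measurable]: "R \<in> sets borel" by (auto simp: R_def)
  have distN: "distr ?N ?N L = ?N"
  proof (rule measure_eqI)
    fix A assume "A \<in> sets (distr ?N ?N L)"
    then have A: "A \<in> sets borel" "A \<subseteq> R"
      using Rb by (auto simp: sN sets_restrict_space_iff)
    have vA: "L -` A \<in> sets borel" using measurable_sets_borel[OF \<open>L \<in> borel_measurable borel\<close> A(1)] .
    have LA: "L -` A \<subseteq> R"
    proof
      fix x assume "x \<in> L -` A"
      then have "L x \<in> R" using A(2) by blast
      then show "x \<in> R" unfolding LR .
    qed
    have "emeasure (distr ?N ?N L) A = emeasure ?N (L -` A \<inter> space ?N)"
      using A by (intro emeasure_distr LN) (simp add: sets_restrict_space_iff)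
    also have "L -` A \<inter> space ?N = L -` A" using LA by (auto simp: space_scale_measure space_restrict_space)
    also have "emeasure ?N (L -` A) = 2 * emeasure lborel (L -` A)"
      using vA LA by (subst emeasure_scale_measure, subst emeasure_restrict_space) auto
    also have "emeasure lborel (L -` A) = emeasure (distr lborel borel L) A"
      using A by (subst emeasure_distr) auto
    also have "\<dots> = emeasure lborel A" by (simp add: lborel_distr_orthogonal[OF orth])
    also have "2 * emeasure lborel A = emeasure ?N A"
      using A by (subst emeasure_scale_measure, subst emeasure_restrict_space) auto
    finally show "emeasure (distr ?N ?N L) A = emeasure ?N A" .
  qed simp
  note [measurable] = measurable_translation_SU2[OF k] LN
  have "distr vol_SU2 vol_SU2 (\<lambda>g. k ** g ** k') =
      distr vol_SU2 (restrict_space borel SU2) (\<lambda>g. k ** g ** k')"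
    by (rule distr_cong) simp_all
  also have "\<dots> = distr ?N (restrict_space borel SU2) (\<lambda>x. k ** \<rho> x ** k')"
    unfolding vol by (subst distr_distr) (auto simp: comp_def)
  also have "\<dots> = distr ?N (restrict_space borel SU2) (\<lambda>x. \<rho> (L x))"
    by (rule distr_cong) (auto simp: \<rho>L space_scale_measure space_restrict_space R_def)
  also have "\<dots> = distr (distr ?N ?N L) (restrict_space borel SU2) \<rho>"
    by (subst distr_distr) (auto simp: comp_def)
  also have "\<dots> = vol_SU2" unfolding distN vol ..
  finally show ?thesis .
qed

lemma finite_measure_vol_SU2: "finite_measure vol_SU2"
  by (rule finite_measureI) (simp add: emeasure_vol_SU2)

lemma measure_vol_SU2: "measure vol_SU2 SU2 = 16 * pi\<^sup>2"
  by (simp add: measure_def emeasure_vol_SU2)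

section \<open>Wigner functions\<close>

lemma finite_spins: "l \<in> half_nats \<Longrightarrow> finite (spins l)"
  by (erule half_natsE) (simp only: spins_half finite_imageI finite_atMost)

lemma card_spins: "l \<in> half_nats \<Longrightarrow> real (card (spins l)) = 2 * l + 1"
  by (erule half_natsE) (simp only: spins_half, subst card_image, auto simp: inj_on_def)

lemma top_spins: "l \<in> half_nats \<Longrightarrow> l \<in> spins l"
  by (elim half_natsE) (force simp: spins_half image_iff)

lemma spins_le: "m \<in> spins l \<Longrightarrow> m \<le> l"
  by (auto simp: spins_def)

lemma uminus_spins: "l \<in> half_nats \<Longrightarrow> m \<in> spins l \<Longrightarrow> - m \<in> spins l"
proof (elim half_natsE)
  fix N assume l: "l = real N / 2" and m: "m \<in> spins l"
  obtain k where k: "m = - (real N / 2) + real k" "k \<le> N" using m unfolding l spins_half by blast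
  then have "- m = - (real N / 2) + real (N - k)" by (simp add: of_nat_diff)
  then show "- m \<in> spins l" unfolding l spins_half by (intro image_eqI[of _ _ "N - k"]) auto
qed

lemma sum_spins_uminus:
  assumes "l \<in> half_nats"
  shows "(\<Sum>m\<in>spins l. f (- m)) = (\<Sum>m\<in>spins l. f m)"
  using uminus_spins[OF assms] by (intro sum.reindex_bij_witness[of _ uminus uminus]) auto

lemma zero_half_nats: "0 \<in> half_nats"
  by (force simp: half_nats_def)

lemma spins_0: "spins 0 = {0}"
  by (auto simp: spins_def)

section \<open>Uniqueness of coefficients and the reproducing kernel\<close>

text \<open>The monomials behind \<open>psi\<close> are linearly independent: at z1 = 1 they become
  distinct powers of one variable with nonzero weights.\<close>

lemma psi_coeffs_unique:
  assumes l: "l \<in> half_nats" and m: "m \<in> spins l"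
    and eq: "\<And>z0 z1. (\<Sum>k\<in>spins l. psi l k z0 z1 * c k) = (\<Sum>k\<in>spins l. psi l k z0 z1 * d k)"
  shows "c m = d m"
proof -
  obtain N where N: "l = real N / 2" using l by (rule half_natsE)
  define w where "w k = complex_of_real (sqrt (real (N choose k)))" for k
  have sum: "(\<Sum>k\<in>spins l. psi l k z 1 * f k) = (\<Sum>k\<le>N. (w k * f (- (real N / 2) + real k)) * z ^ k)" for f z
    unfolding N sum_spins_half by (intro sum.cong refl) (simp only: psi_half atMost_iff w_def, simp)
  obtain k where k: "m = - (real N / 2) + real k" "k \<le> N" using m unfolding N spins_half by blast
  have "w k * c m = w k * d m"
    using polyfun_eq_coeffs[of "\<lambda>k. w k * c (- (real N / 2) + real k)" N
        "\<lambda>k. w k * d (- (real N / 2) + real k)"] eq[of _ 1] k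
    unfolding sum by simp
  moreover have "w k \<noteq> 0" using k(2) by (simp add: w_def binomial_eq_0_iff)
  ultimately show ?thesis by simp
qed

text \<open>This is the binomial theorem, for which the square roots in \<open>psi\<close> are made.
  The sum is the reproducing kernel of the homogeneous polynomials; its invariance under
  simultaneous unitary changes of z and w is the source of the unitarity of the Wigner
  matrices.\<close>

lemma sum_psi_cnj_psi:
  assumes "l \<in> half_nats"
  shows "(\<Sum>m\<in>spins l. psi l m z0 z1 * cnj (psi l m w0 w1)) = (z0 * cnj w0 + z1 * cnj w1) ^ nat \<lfloor>2 * l\<rfloor>"
proof -
  obtain N where N: "l = real N / 2" using assms by (rule half_natsE)
  have sq: "complex_of_real (sqrt (real (N choose k))) * complex_of_real (sqrt (real (N choose k))) = of_nat (N choose k)" for k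
    by (simp flip: of_real_mult)
  have psi: "psi (real N / 2) (- (real N / 2) + real k) z0 z1 * cnj (psi (real N / 2) (- (real N / 2) + real k) w0 w1) =
      of_nat (N choose k) * (z0 * cnj w0) ^ k * (z1 * cnj w1) ^ (N - k)" if "k \<le> N" for k
    using that by (simp only: psi_half complex_cnj_mult complex_cnj_power complex_cnj_complex_of_real
        power_mult_distrib) (simp add: mult_ac flip: sq)
  have NN: "nat \<lfloor>2 * l\<rfloor> = N" by (simp add: N)
  show ?thesis
    unfolding NN binomial_ring unfolding N sum_spins_half by (intro sum.cong refl psi) simp
qed

text \<open>Compares the reproducing kernel \<open>\<langle>w, g\<inverse>z\<rangle>\<close> with \<open>\<langle>g w, z\<rangle>\<close>, where
  \<open>h (cnj \<alpha>) (- \<beta>)\<close> is the adjoint, hence for unit vectors the inverse, of \<open>g = h \<alpha> \<beta>\<close>.\<close>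

lemma wignerD_adjoint:
  assumes l: "l \<in> half_nats" and m: "m \<in> spins l" and s: "s \<in> spins l"
  shows "wignerD l m s (h \<alpha> \<beta>) = cnj (wignerD l s m (h (cnj \<alpha>) (- \<beta>)))"
proof -
  let ?D = "\<lambda>m s. wignerD l m s (h \<alpha> \<beta>)" and ?E = "\<lambda>m s. wignerD l m s (h (cnj \<alpha>) (- \<beta>))"
  \<comment> \<open>For fixed w the kernel is a polynomial in z, whose coefficients are compared
    here; the coefficients in w follow in a second comparison.\<close>
  have 1: "(\<Sum>s\<in>spins l. cnj (psi l s w0 w1) * ?D m s) = (\<Sum>s\<in>spins l. cnj (psi l s w0 w1) * cnj (?E s m))"
    if "m \<in> spins l" for m w0 w1
  proof (rule psi_coeffs_unique[OF l that])
    fix z0 z1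
    have "(\<Sum>k\<in>spins l. psi l k z0 z1 * (\<Sum>s\<in>spins l. cnj (psi l s w0 w1) * ?D k s)) =
        (\<Sum>s\<in>spins l. (\<Sum>k\<in>spins l. psi l k z0 z1 * ?D k s) * cnj (psi l s w0 w1))"
      unfolding sum_distrib_left sum_distrib_right by (subst sum.swap) (simp add: mult_ac)
    also have "\<dots> = ((cnj \<alpha> * z0 + cnj \<beta> * z1) * cnj w0 + (- \<beta> * z0 + \<alpha> * z1) * cnj w1) ^ nat \<lfloor>2 * l\<rfloor>"
      by (simp only: wignerD_eq[OF l] sum_psi_cnj_psi[OF l] cong: sum.cong)
    also have "\<dots> = (z0 * cnj (\<alpha> * w0 - cnj \<beta> * w1) + z1 * cnj (\<beta> * w0 + cnj \<alpha> * w1)) ^ nat \<lfloor>2 * l\<rfloor>"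
      by (simp add: algebra_simps)
    also have "\<dots> = (\<Sum>k\<in>spins l. psi l k z0 z1 * cnj (psi l k (\<alpha> * w0 - cnj \<beta> * w1) (\<beta> * w0 + cnj \<alpha> * w1)))"
      by (rule sum_psi_cnj_psi[OF l, symmetric])
    also have "\<dots> = (\<Sum>k\<in>spins l. psi l k z0 z1 * cnj (\<Sum>s\<in>spins l. psi l s w0 w1 * ?E s k))"
    proof (intro sum.cong refl)
      fix k assume "k \<in> spins l"
      from wignerD_eq[OF l this, of w0 w1 "cnj \<alpha>" "- \<beta>"]
      show "psi l k z0 z1 * cnj (psi l k (\<alpha> * w0 - cnj \<beta> * w1) (\<beta> * w0 + cnj \<alpha> * w1)) =
        psi l k z0 z1 * cnj (\<Sum>s\<in>spins l. psi l s w0 w1 * ?E s k)" by (simp del: cnj_sum)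
    qed
    also have "\<dots> = (\<Sum>k\<in>spins l. psi l k z0 z1 * (\<Sum>s\<in>spins l. cnj (psi l s w0 w1) * cnj (?E s k)))"
      by simp
    finally show "(\<Sum>k\<in>spins l. psi l k z0 z1 * (\<Sum>s\<in>spins l. cnj (psi l s w0 w1) * ?D k s)) =
      (\<Sum>k\<in>spins l. psi l k z0 z1 * (\<Sum>s\<in>spins l. cnj (psi l s w0 w1) * cnj (?E s k)))" .
  qed
  have "cnj (?D m s) = ?E s m"
  proof (rule psi_coeffs_unique[OF l s])
    fix z0 z1
    show "(\<Sum>s\<in>spins l. psi l s z0 z1 * cnj (?D m s)) = (\<Sum>s\<in>spins l. psi l s z0 z1 * ?E s m)"
      using arg_cong[OF 1[OF m, of z0 z1], of cnj] by simp
  qed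
  then show ?thesis by (metis complex_cnj_cnj)
qed

section \<open>The Wigner matrices as a unitary representation\<close>

text \<open>The linear substitution attached to a product is the composition of the two
  substitutions; expanding it in two stages gives the matrix product.\<close>

lemma wignerD_h_mult:
  assumes l: "l \<in> half_nats" and m: "m \<in> spins l" and s: "s \<in> spins l"
  shows "wignerD l m s (h \<alpha> \<beta> ** h \<alpha>' \<beta>') = (\<Sum>p\<in>spins l. wignerD l m p (h \<alpha> \<beta>) * wignerD l p s (h \<alpha>' \<beta>'))"
  unfolding h_mult
proof (rule wignerD_unique[OF l s m])
  fix z0 z1
  let ?u0 = "cnj \<alpha> * z0 + cnj \<beta> * z1" and ?u1 = "- \<beta> * z0 + \<alpha> * z1"
  have "(\<Sum>k\<in>spins l. psi l k z0 z1 * (\<Sum>p\<in>spins l. wignerD l k p (h \<alpha> \<beta>) * wignerD l p s (h \<alpha>' \<beta>'))) =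
     (\<Sum>p\<in>spins l. (\<Sum>k\<in>spins l. psi l k z0 z1 * wignerD l k p (h \<alpha> \<beta>)) * wignerD l p s (h \<alpha>' \<beta>'))"
    unfolding sum_distrib_left sum_distrib_right by (subst sum.swap) (simp add: mult_ac)
  also have "\<dots> = (\<Sum>p\<in>spins l. psi l p ?u0 ?u1 * wignerD l p s (h \<alpha>' \<beta>'))"
    by (simp only: wignerD_eq[OF l] cong: sum.cong)
  also have "\<dots> = psi l s (cnj \<alpha>' * ?u0 + cnj \<beta>' * ?u1) (- \<beta>' * ?u0 + \<alpha>' * ?u1)"
    by (rule wignerD_eq[OF l s])
  also have "cnj \<alpha>' * ?u0 + cnj \<beta>' * ?u1 =
      cnj (\<alpha> * \<alpha>' - cnj \<beta> * \<beta>') * z0 + cnj (\<beta> * \<alpha>' + cnj \<alpha> * \<beta>') * z1"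
    by (simp add: algebra_simps)
  also have "- \<beta>' * ?u0 + \<alpha>' * ?u1 =
      - (\<beta> * \<alpha>' + cnj \<alpha> * \<beta>') * z0 + (\<alpha> * \<alpha>' - cnj \<beta> * \<beta>') * z1"
    by (simp add: algebra_simps)
  finally show "(\<Sum>k\<in>spins l. psi l k z0 z1 * (\<Sum>p\<in>spins l. wignerD l k p (h \<alpha> \<beta>) * wignerD l p s (h \<alpha>' \<beta>'))) =
     psi l s (cnj (\<alpha> * \<alpha>' - cnj \<beta> * \<beta>') * z0 + cnj (\<beta> * \<alpha>' + cnj \<alpha> * \<beta>') * z1)
       (- (\<beta> * \<alpha>' + cnj \<alpha> * \<beta>') * z0 + (\<alpha> * \<alpha>' - cnj \<beta> * \<beta>') * z1)" .
qed

lemma wignerD_mult: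
  assumes "l \<in> half_nats" "m \<in> spins l" "s \<in> spins l" "g \<in> SU2" "k \<in> SU2"
  shows "wignerD l m s (g ** k) = (\<Sum>p\<in>spins l. wignerD l m p g * wignerD l p s k)"
  using wignerD_h_mult[OF assms(1-3), of "g$1$1" "g$2$1" "k$1$1" "k$2$1"]
  by (simp flip: SU2_eq_h[OF assms(4)] SU2_eq_h[OF assms(5)])

text \<open>A diagonal matrix scales z0 by exp(-it) and z1 by exp(it), hence the monomial of weight
  s by exp(-it(l+s) + it(l-s)) = exp(-2ist). These phases tell the weights apart.\<close>

lemma wignerD_diag:
  assumes l: "l \<in> half_nats" and m: "m \<in> spins l" and s: "s \<in> spins l"
  shows "wignerD l m s (h (cis t) 0) = of_bool (m = s) * cis (- (2 * m * t))"
proof (rule wignerD_unique[OF l s m])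
  fix z0 z1
  have "(\<Sum>k\<in>spins l. psi l k z0 z1 * (of_bool (k = s) * cis (- (2 * k * t)))) =
      (\<Sum>k\<in>spins l. if k = s then psi l k z0 z1 * cis (- (2 * k * t)) else 0)"
    by (intro sum.cong) auto
  also have "\<dots> = psi l s z0 z1 * cis (- (2 * s * t))"
    using s by (simp add: finite_spins[OF l])
  also have "\<dots> = psi l s (cnj (cis t) * z0) (cis t * z1)"
  proof -
    obtain N where N: "l = real N / 2" using l by (rule half_natsE)
    obtain k where k: "s = - (real N / 2) + real k" "k \<le> N" using s unfolding N spins_half by blast
    have "cis (- t) ^ k * cis t ^ (N - k) = cis (- (2 * s * t))"
    proof -
      have "cis (- t) ^ k * cis t ^ (N - k) = cis (real k * - t + real (N - k) * t)"
        unfolding Complex.DeMoivre cis_mult ..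
      also have "real k * - t + real (N - k) * t = - (2 * s * t)"
        using k(2) by (simp add: k(1) of_nat_diff algebra_simps)
      finally show ?thesis .
    qed
    then show ?thesis
      unfolding N k(1) by (simp only: psi_half[OF k(2)] power_mult_distrib cis_cnj) (simp add: k(1) mult_ac)
  qed
  finally show "(\<Sum>k\<in>spins l. psi l k z0 z1 * (of_bool (k = s) * cis (- (2 * k * t)))) =
      psi l s (cnj (cis t) * z0 + cnj 0 * z1) (- 0 * z0 + cis t * z1)" by simp
qed

text \<open>D(g) times its adjoint is D of g times its adjoint, that is D(1); writing the identity
  as \<open>h (cis 0) 0\<close> lets \<open>wignerD_diag\<close> evaluate it.\<close>

lemma wignerD_row_orthonormal:
  assumes l: "l \<in> half_nats" and m: "m \<in> spins l" and m': "m' \<in> spins l" and g: "g \<in> SU2"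
  shows "(\<Sum>s\<in>spins l. wignerD l m s g * cnj (wignerD l m' s g)) = of_bool (m = m')"
proof -
  obtain \<alpha> \<beta> where g: "g = h \<alpha> \<beta>" and 1: "(cmod \<alpha>)\<^sup>2 + (cmod \<beta>)\<^sup>2 = 1"
    using g by (auto simp: SU2_def)
  have 2: "\<alpha> * cnj \<alpha> + \<beta> * cnj \<beta> = 1" using 1 by (metis complex_norm_square of_real_1 of_real_add)
  have "(\<Sum>s\<in>spins l. wignerD l m s g * cnj (wignerD l m' s g)) =
      (\<Sum>s\<in>spins l. wignerD l m s (h \<alpha> \<beta>) * wignerD l s m' (h (cnj \<alpha>) (- \<beta>)))"
    unfolding g using wignerD_adjoint[OF l _ m', of _ "cnj \<alpha>" "- \<beta>"] by (intro sum.cong) simp_all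
  also have "\<dots> = wignerD l m m' (h \<alpha> \<beta> ** h (cnj \<alpha>) (- \<beta>))"
    by (rule wignerD_h_mult[OF l m m', symmetric])
  also have "h \<alpha> \<beta> ** h (cnj \<alpha>) (- \<beta>) = h (cis 0) 0"
    unfolding h_mult using 2 by (simp add: mult_ac)
  finally show ?thesis by (simp only: wignerD_diag[OF l m m']) simp
qed

text \<open>The row relation at the inverse matrix, transposed by
  \<open>wignerD_adjoint\<close>.\<close>

lemma wignerD_column_orthonormal:
  assumes l: "l \<in> half_nats" and s: "s \<in> spins l" and s': "s' \<in> spins l" and g: "g \<in> SU2"
  shows "(\<Sum>m\<in>spins l. cnj (wignerD l m s g) * wignerD l m s' g) = of_bool (s = s')"
proof -
  obtain \<alpha> \<beta> where g: "g = h \<alpha> \<beta>" and 1: "norm (\<alpha>, \<beta>) = 1"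
    using g by (rule SU2E)
  have "h (cnj \<alpha>) (- \<beta>) \<in> SU2" using 1 by (simp add: h_in_SU2_iff norm_prod_def)
  from wignerD_row_orthonormal[OF l s s' this] show ?thesis
    unfolding g using wignerD_adjoint[OF l _ s, of _ \<alpha> \<beta>] wignerD_adjoint[OF l _ s', of _ \<alpha> \<beta>]
    by simp
qed

text \<open>An entry of a row of norm 1. The uniform bounds on \<open>phi\<close> in the
  integrability arguments come from here.\<close>

lemma cmod_wignerD_le:
  assumes "l \<in> half_nats" "m \<in> spins l" "s \<in> spins l" "g \<in> SU2"
  shows "cmod (wignerD l m s g) \<le> 1"
proof -
  have "complex_of_real (\<Sum>s\<in>spins l. (cmod (wignerD l m s g))\<^sup>2) = 1"
    using wignerD_row_orthonormal[OF assms(1,2,2,4)] by (simp add: complex_norm_square del: of_real_power)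
  then have "(\<Sum>s\<in>spins l. (cmod (wignerD l m s g))\<^sup>2) = 1" using of_real_eq_1_iff by blast
  then have "(cmod (wignerD l m s g))\<^sup>2 \<le> 1"
    using member_le_sum[OF assms(3), of "\<lambda>s. (cmod (wignerD l m s g))\<^sup>2"] finite_spins[OF assms(1)] by simp
  then show ?thesis by (simp add: power_le_one_iff)
qed

text \<open>For the highest weight \<open>psi\<close> is z0^(2l), which the substitution turns into
  (cnj \<alpha> z0 + cnj \<beta> z1)^(2l); none of its binomial terms is 0. The row follows from the
  column by \<open>wignerD_adjoint\<close>. This is the form of irreducibility that Schur's lemma
  uses.\<close>

lemma wignerD_top_nonzero:
  assumes l: "l \<in> half_nats" and m: "m \<in> spins l" and "\<alpha> \<noteq> 0" "\<beta> \<noteq> 0"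
  shows "wignerD l m l (h \<alpha> \<beta>) \<noteq> 0" "wignerD l l m (h \<alpha> \<beta>) \<noteq> 0"
proof -
  obtain N where N: "l = real N / 2" using l by (rule half_natsE)
  \<comment> \<open>One square root of the binomial coefficient is kept here; the other is the one
    inside \<open>psi\<close>.\<close>
  define d where "d \<alpha> \<beta> k = complex_of_real (sqrt (real (N choose nat \<lfloor>l + k\<rfloor>))) * cnj \<alpha> ^ nat \<lfloor>l + k\<rfloor> * cnj \<beta> ^ (N - nat \<lfloor>l + k\<rfloor>)"
    for \<alpha> \<beta> :: complex and k :: real
  have idx: "nat \<lfloor>l + (- (real N / 2) + real k)\<rfloor> = k" for k by (simp add: N)
  have 1: "wignerD l m l (h \<alpha> \<beta>) = d \<alpha> \<beta> m" for \<alpha> \<beta>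
  proof (rule wignerD_unique[OF l top_spins[OF l] m])
    fix z0 z1
    have "psi l l (cnj \<alpha> * z0 + cnj \<beta> * z1) u = (cnj \<alpha> * z0 + cnj \<beta> * z1) ^ N" for u
      using psi_half[of N N] by (simp add: N)
    also have "\<dots> = (\<Sum>k\<le>N. psi l (- (real N / 2) + real k) z0 z1 * d \<alpha> \<beta> (- (real N / 2) + real k))"
    proof (subst binomial_ring, rule sum.cong[OF refl])
      fix k assume "k \<in> {..N}"
      then have k: "k \<le> N" by simp
      have sq: "complex_of_real (sqrt (real (N choose k))) * complex_of_real (sqrt (real (N choose k))) = of_nat (N choose k)"
        by (simp flip: of_real_mult)
      show "of_nat (N choose k) * (cnj \<alpha> * z0) ^ k * (cnj \<beta> * z1) ^ (N - k) =
          psi l (- (real N / 2) + real k) z0 z1 * d \<alpha> \<beta> (- (real N / 2) + real k)"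
        unfolding d_def idx unfolding N by (simp only: psi_half[OF k] power_mult_distrib) (simp add: mult_ac flip: sq)
    qed
    finally show "(\<Sum>k\<in>spins l. psi l k z0 z1 * d \<alpha> \<beta> k) = psi l l (cnj \<alpha> * z0 + cnj \<beta> * z1) (- \<beta> * z0 + \<alpha> * z1)"
      unfolding N sum_spins_half by simp
  qed
  obtain k where "m = - (real N / 2) + real k" "k \<le> N" using m unfolding N spins_half by blast
  then have "nat \<lfloor>l + m\<rfloor> \<le> N" using idx by simp
  then have 2: "d \<alpha> \<beta> m \<noteq> 0" if "\<alpha> \<noteq> 0" "\<beta> \<noteq> 0" for \<alpha> \<beta>
    using that by (simp add: d_def binomial_eq_0_iff)
  show "wignerD l m l (h \<alpha> \<beta>) \<noteq> 0" using 1 2 assms by simp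
  show "wignerD l l m (h \<alpha> \<beta>) \<noteq> 0"
    using 1 2[of "cnj \<alpha>" "- \<beta>"] assms wignerD_adjoint[OF l top_spins[OF l] m] by simp
qed

text \<open>The antilinear map \<open>(z0, z1) \<mapsto> (cnj z1, - cnj z0)\<close> commutes with every \<open>h \<alpha> \<beta>\<close>; this turns
  the following symmetry of \<open>psi\<close> into one of the Wigner functions.\<close>

lemma psi_quaternion:
  assumes l: "l \<in> half_nats" and m: "m \<in> spins l"
  shows "psi l m (cnj z1) (- cnj z0) = (- 1) ^ nat \<lfloor>l - m\<rfloor> * cnj (psi l (- m) z0 z1)"
proof -
  obtain N where N: "l = real N / 2" using l by (rule half_natsE)
  obtain k where k: "m = - (real N / 2) + real k" "k \<le> N" using m unfolding N spins_half by blast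
  have m': "- m = - (real N / 2) + real (N - k)" and lm: "l - m = real (N - k)"
    using k by (simp_all add: N of_nat_diff)
  have e: "nat \<lfloor>l - m\<rfloor> = N - k" unfolding lm by simp
  show ?thesis
    unfolding e m' unfolding k(1) N psi_half[OF k(2)] psi_half[OF diff_le_self]
    using k(2) by (simp add: power_minus[of "cnj z0"] binomial_symmetric[OF k(2)] mult_ac)
qed

lemma cnj_wignerD:
  assumes l: "l \<in> half_nats" and m: "m \<in> spins l" and s: "s \<in> spins l" and g: "g \<in> SU2"
  shows "wignerD l (- m) (- s) g = (- 1) ^ nat \<lfloor>l - m\<rfloor> * (- 1) ^ nat \<lfloor>l - s\<rfloor> * cnj (wignerD l m s g)"
proof -
  obtain \<alpha> \<beta> where g: "g = h \<alpha> \<beta>" using g by (auto simp: SU2_def)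
  define e :: "real \<Rightarrow> complex" where "e m = (- 1) ^ nat \<lfloor>l - m\<rfloor>" for m
  have e: "cnj (e m) = e m" "e m * e m = 1" for m
    by (simp_all add: e_def flip: power_mult_distrib)
  define d where "d k = e (- k) * e s * cnj (wignerD l (- k) s g)" for k
  have "wignerD l (- m) (- s) (h \<alpha> \<beta>) = d (- m)"
  proof (rule wignerD_unique[OF l])
    fix z0 z1
    let ?u0 = "cnj \<alpha> * z0 + cnj \<beta> * z1" and ?u1 = "- \<beta> * z0 + \<alpha> * z1"
    have "(\<Sum>k\<in>spins l. psi l k z0 z1 * d k) = (\<Sum>k\<in>spins l. psi l (- k) z0 z1 * d (- k))"
      by (rule sum_spins_uminus[OF l, symmetric])
    also have "\<dots> = (\<Sum>k\<in>spins l. e s * cnj (psi l k (cnj z1) (- cnj z0) * wignerD l k s g))"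
      using psi_quaternion[OF l] by (intro sum.cong refl) (simp add: d_def e_def mult_ac)
    also have "\<dots> = e s * cnj (\<Sum>k\<in>spins l. psi l k (cnj z1) (- cnj z0) * wignerD l k s g)"
      by (simp add: sum_distrib_left)
    also have "\<dots> = e s * cnj (psi l s (cnj \<alpha> * cnj z1 + cnj \<beta> * - cnj z0) (- \<beta> * cnj z1 + \<alpha> * - cnj z0))"
      unfolding g by (simp only: wignerD_eq[OF l s])
    \<comment> \<open>The substitution commutes with the antilinear map, so the arguments are again
      of the form (cnj u1, - cnj u0) and \<open>psi_quaternion\<close> applies once more.\<close>
    also have "cnj \<alpha> * cnj z1 + cnj \<beta> * - cnj z0 = cnj ?u1" by simp
    also have "- \<beta> * cnj z1 + \<alpha> * - cnj z0 = - cnj ?u0" by simp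
    also have "e s * cnj (psi l s (cnj ?u1) (- cnj ?u0)) = e s * e s * psi l (- s) ?u0 ?u1"
      unfolding psi_quaternion[OF l s] by (simp add: e_def)
    also have "\<dots> = psi l (- s) ?u0 ?u1" by (simp add: e)
    finally show "(\<Sum>k\<in>spins l. psi l k z0 z1 * d k) = psi l (- s) ?u0 ?u1" .
  qed (use m s uminus_spins[OF l] in auto)
  then show ?thesis by (simp add: g d_def e_def)
qed

section \<open>Measurability of the Wigner functions\<close>

text \<open>\<open>wignerD\<close> is a definite description, so its dependence on the matrix is not
  explicit. Multiplying the linear factors one at a time expresses the polynomial coefficients by
  sums and products of p, q, r, t, which keeps them measurable.\<close>

lemma homogeneous_measurable:
  fixes p q r t :: "'a \<Rightarrow> complex"
  assumes [measurable]: "p \<in> borel_measurable M" "q \<in> borel_measurable M"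
    "r \<in> borel_measurable M" "t \<in> borel_measurable M"
  shows "\<exists>e. (\<forall>k. e k \<in> borel_measurable M) \<and> (\<forall>x z0 z1.
     (p x * z0 + q x * z1) ^ i * (r x * z0 + t x * z1) ^ j = (\<Sum>k\<le>i + j. e k x * z0 ^ k * z1 ^ (i + j - k)))"
proof -
  define P where "P n f \<longleftrightarrow> (\<exists>e. (\<forall>k. e k \<in> borel_measurable M) \<and>
     (\<forall>x z0 z1. f x z0 z1 = (\<Sum>k\<le>n. e k x * z0 ^ k * z1 ^ (n - k))))"
    for n and f :: "'a \<Rightarrow> complex \<Rightarrow> complex \<Rightarrow> complex"
  have step: "P (Suc n) (\<lambda>x z0 z1. (p x * z0 + q x * z1) * f x z0 z1)"
    if "P n f" and [measurable]: "p \<in> borel_measurable M" "q \<in> borel_measurable M"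
    for n f and p q :: "'a \<Rightarrow> complex"
  proof -
    obtain e where [measurable]: "\<And>k. e k \<in> borel_measurable M"
      and e: "\<And>x z0 z1. f x z0 z1 = (\<Sum>k\<le>n. e k x * z0 ^ k * z1 ^ (n - k))"
      using \<open>P n f\<close> unfolding P_def by blast
    define e' where "e' k x = (if k = 0 then 0 else p x * e (k - 1) x) + (if k \<le> n then q x * e k x else 0)" for k x
    have "(p x * z0 + q x * z1) * f x z0 z1 = (\<Sum>k\<le>Suc n. e' k x * z0 ^ k * z1 ^ (Suc n - k))" for x z0 z1
    proof -
      have 1: "(\<Sum>k\<le>Suc n. (if k = 0 then 0 else p x * e (k - 1) x) * z0 ^ k * z1 ^ (Suc n - k)) =
         p x * z0 * f x z0 z1"
        unfolding e sum.atMost_Suc_shift sum_distrib_left by (simp add: mult_ac)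
      have 2: "(\<Sum>k\<le>Suc n. (if k \<le> n then q x * e k x else 0) * z0 ^ k * z1 ^ (Suc n - k)) =
         q x * z1 * f x z0 z1"
        unfolding e sum.atMost_Suc sum_distrib_left by (simp add: Suc_diff_le mult_ac)
      show ?thesis unfolding e'_def distrib_right sum.distrib 1 2 by simp
    qed
    moreover have "e' k \<in> borel_measurable M" for k unfolding e'_def[abs_def] by measurable
    ultimately show ?thesis unfolding P_def by blast
  qed
  have "P 0 (\<lambda>x z0 z1. 1)" unfolding P_def by (intro exI[of _ "\<lambda>_ _. 1"]) simp
  then have "P j (\<lambda>x z0 z1. (r x * z0 + t x * z1) ^ j)"
    by (induction j) (use step in \<open>simp_all add: mult.assoc\<close>)
  then have "P (i + j) (\<lambda>x z0 z1. (p x * z0 + q x * z1) ^ i * (r x * z0 + t x * z1) ^ j)"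
    by (induction i) (use step in \<open>simp_all add: mult.assoc\<close>)
  then show ?thesis unfolding P_def .
qed

lemma wignerD_measurable:
  assumes l: "l \<in> half_nats" and m: "m \<in> spins l" and s: "s \<in> spins l"
  shows "wignerD l m s \<in> borel_measurable borel"
proof -
  obtain N where N: "l = real N / 2" using l by (rule half_natsE)
  obtain j where j: "s = - (real N / 2) + real j" "j \<le> N" using s unfolding N spins_half by blast
  define w where "w k = complex_of_real (sqrt (real (N choose k)))" for k
  have w0: "w k \<noteq> 0" if "k \<le> N" for k using that by (simp add: w_def binomial_eq_0_iff)
  have "\<exists>e. (\<forall>k. e k \<in> borel_measurable borel) \<and> (\<forall>(g :: complex^2^2) z0 z1.
     (cnj (g$1$1) * z0 + cnj (g$2$1) * z1) ^ j * (- (g$2$1) * z0 + g$1$1 * z1) ^ (N - j) =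
     (\<Sum>k\<le>j + (N - j). e k g * z0 ^ k * z1 ^ (j + (N - j) - k)))"
    by (rule homogeneous_measurable) (intro borel_measurable_continuous_onI continuous_intros)+
  then obtain e where [measurable]: "\<And>k. e k \<in> borel_measurable borel"
    and e: "\<And>g :: complex^2^2. \<And>z0 z1.
     (cnj (g$1$1) * z0 + cnj (g$2$1) * z1) ^ j * (- (g$2$1) * z0 + g$1$1 * z1) ^ (N - j) =
     (\<Sum>k\<le>N. e k g * z0 ^ k * z1 ^ (N - k))"
    using j(2) by auto
  define d where "d g k = w j * e (nat \<lfloor>l + k\<rfloor>) g / w (nat \<lfloor>l + k\<rfloor>)" for g k
  have "wignerD l m s g = d g m" for g
  proof -
    \<comment> \<open>The definition reads only the first column, so the argument covers all
      matrices and not just those in SU(2).\<close>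
    have "wignerD l m s g = wignerD l m s (h (g$1$1) (g$2$1))" by (simp add: wignerD_def)
    also have "\<dots> = d g m"
    proof (rule wignerD_unique[OF l s m])
      fix z0 z1
      have idx: "nat \<lfloor>l + (- (real N / 2) + real k)\<rfloor> = k" for k by (simp add: N)
      have "psi l (- (real N / 2) + real k) z0 z1 * d g (- (real N / 2) + real k) =
          w j * (e k g * z0 ^ k * z1 ^ (N - k))" if "k \<le> N" for k
        using w0[OF that] unfolding d_def idx unfolding N psi_half[OF that] w_def[symmetric] by (simp add: field_simps)
      then show "(\<Sum>k\<in>spins l. psi l k z0 z1 * d g k) =
           psi l s (cnj (g$1$1) * z0 + cnj (g$2$1) * z1) (- (g$2$1) * z0 + g$1$1 * z1)"
        unfolding j(1) N sum_spins_half psi_half[OF j(2)] w_def[symmetric] mult.assoc[of "w j"] e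
        by (simp add: sum_distrib_left)
    qed
    finally show ?thesis .
  qed
  moreover have "(\<lambda>g. d g m) \<in> borel_measurable borel" unfolding d_def by measurable
  ultimately show ?thesis by (simp add: fun_eq_iff cong: measurable_cong)
qed

section \<open>Schur's lemma for the Wigner matrices\<close>

text \<open>Diagonal matrices force an intertwiner to be diagonal; a group element with no vanishing
  matrix coefficient in the row and in the column of highest weight makes the diagonal constant.\<close>

lemma wignerD_schur:
  assumes l: "l \<in> half_nats" and l': "l' \<in> half_nats"
    and T: "\<And>g m m'. g \<in> SU2 \<Longrightarrow> m \<in> spins l \<Longrightarrow> m' \<in> spins l' \<Longrightarrow>
      T m m' = (\<Sum>p\<in>spins l. \<Sum>p'\<in>spins l'. wignerD l m p g * cnj (wignerD l' m' p' g) * T p p')"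
    and m: "m \<in> spins l" and m': "m' \<in> spins l'"
  shows "T m m' = of_bool (l = l' \<and> m = m') * T l l"
proof -
  note fin[simp] = finite_spins[OF l] finite_spins[OF l']
  have off: "T m m' = 0" if m: "m \<in> spins l" and m': "m' \<in> spins l'" and "m \<noteq> m'" for m m'
  proof -
    \<comment> \<open>Chosen so that 2 (m - m') t = pi: the relation at this diagonal matrix then
      reads \<open>T m m' = - T m m'\<close>.\<close>
    define t where "t = pi / (2 * (m - m'))"
    have "h (cis t) 0 \<in> SU2" by (simp add: h_in_SU2_iff norm_prod_def)
    from T[OF this m m'] have "T m m' =
       (\<Sum>p\<in>spins l. \<Sum>p'\<in>spins l'. wignerD l m p (h (cis t) 0) * cnj (wignerD l' m' p' (h (cis t) 0)) * T p p')" .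
    also have "\<dots> = (\<Sum>p\<in>spins l. \<Sum>p'\<in>spins l'.
        if m = p then if m' = p' then cis (- (2 * m * t)) * cnj (cis (- (2 * m' * t))) * T p p' else 0 else 0)"
      using m m' by (intro sum.cong refl) (simp add: wignerD_diag l l')
    also have "\<dots> = (\<Sum>p\<in>spins l. if m = p then (\<Sum>p'\<in>spins l'.
        if m' = p' then cis (- (2 * m * t)) * cnj (cis (- (2 * m' * t))) * T p p' else 0) else 0)"
      by (intro sum.cong refl) simp
    also have "\<dots> = cis (- (2 * m * t)) * cnj (cis (- (2 * m' * t))) * T m m'"
      using m m' by simp
    also have "cis (- (2 * m * t)) * cnj (cis (- (2 * m' * t))) = cis (- (2 * (m - m') * t))"
      by (simp add: cis_cnj cis_mult algebra_simps)
    also have "- (2 * (m - m') * t) = - pi" using \<open>m \<noteq> m'\<close> by (simp add: t_def field_simps)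
    finally show "T m m' = 0" by (simp flip: cis_cnj)
  qed
  \<comment> \<open>Moving the conjugate factor to the other side by column orthonormality turns
    invariance into the intertwining relation T D' = D T.\<close>
  have inter: "(\<Sum>m'\<in>spins l'. T m m' * wignerD l' m' q g) = (\<Sum>p\<in>spins l. wignerD l m p g * T p q)"
    if g: "g \<in> SU2" and m: "m \<in> spins l" and q: "q \<in> spins l'" for g m q
  proof -
    have "(\<Sum>m'\<in>spins l'. T m m' * wignerD l' m' q g) = (\<Sum>m'\<in>spins l'. \<Sum>p\<in>spins l. \<Sum>p'\<in>spins l'.
        wignerD l m p g * T p p' * (cnj (wignerD l' m' p' g) * wignerD l' m' q g))"
    proof (intro sum.cong refl)
      fix m' assume "m' \<in> spins l'"
      then show "T m m' * wignerD l' m' q g = (\<Sum>p\<in>spins l. \<Sum>p'\<in>spins l'.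
        wignerD l m p g * T p p' * (cnj (wignerD l' m' p' g) * wignerD l' m' q g))"
        unfolding T[OF g m \<open>m' \<in> spins l'\<close>] sum_distrib_right by (simp only: mult_ac)
    qed
    also have "\<dots> = (\<Sum>p\<in>spins l. \<Sum>m'\<in>spins l'. \<Sum>p'\<in>spins l'.
        wignerD l m p g * T p p' * (cnj (wignerD l' m' p' g) * wignerD l' m' q g))"
      by (rule sum.swap)
    also have "\<dots> = (\<Sum>p\<in>spins l. \<Sum>p'\<in>spins l'. \<Sum>m'\<in>spins l'.
        wignerD l m p g * T p p' * (cnj (wignerD l' m' p' g) * wignerD l' m' q g))"
      by (intro sum.cong refl sum.swap)
    also have "\<dots> = (\<Sum>p\<in>spins l. \<Sum>p'\<in>spins l'. if p' = q then wignerD l m p g * T p p' else 0)"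
      by (intro sum.cong refl) (simp add: wignerD_column_orthonormal[OF l' _ q g] flip: sum_distrib_left)
    also have "\<dots> = (\<Sum>p\<in>spins l. wignerD l m p g * T p q)" using q by simp
    finally show ?thesis .
  qed
  \<comment> \<open>The value 1 / sqrt 2 puts \<open>h a a\<close> into SU(2) with both entries of
    its first column nonzero.\<close>
  define a where "a = complex_of_real (1 / sqrt 2)"
  have a: "a \<noteq> 0" by (simp add: a_def)
  have haa: "h a a \<in> SU2" by (simp add: h_in_SU2_iff norm_prod_def a_def power_divide norm_divide)
  \<comment> \<open>As T is diagonal, each sum of the intertwining relation has at most one term;
    the guards cover spins whose index sets differ.\<close>
  have diag: "(if m \<in> spins l' then T m m * wignerD l' m q (h a a) else 0) =
      (if q \<in> spins l then wignerD l m q (h a a) * T q q else 0)"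
    if m: "m \<in> spins l" and q: "q \<in> spins l'" for m q
  proof -
    have "(\<Sum>m'\<in>spins l'. T m m' * wignerD l' m' q (h a a)) =
        (\<Sum>m'\<in>spins l'. if m = m' then T m m * wignerD l' m q (h a a) else 0)"
      using off[OF m] by (intro sum.cong refl) auto
    moreover have "(\<Sum>p\<in>spins l. wignerD l m p (h a a) * T p q) =
        (\<Sum>p\<in>spins l. if p = q then wignerD l m q (h a a) * T q q else 0)"
      using off[OF _ q] by (intro sum.cong refl) auto
    ultimately show ?thesis using inter[OF haa m q] by simp
  qed
  show ?thesis
  proof (cases "m = m'")
    case mm: True
    show ?thesis
    proof (cases "l = l'")
      case True
      then show ?thesis
        using diag[OF m, of l] m top_spins[OF l] wignerD_top_nonzero(1)[OF l m a a] mm by simp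
    next
      case False
      \<comment> \<open>The larger spin is no index of the smaller one. At that index one side of
        \<open>diag\<close> is 0, and the other is \<open>T m m\<close> times a nonzero Wigner
        coefficient.\<close>
      then have "l \<notin> spins l' \<or> l' \<notin> spins l" using spins_le[of l l'] spins_le[of l' l] by linarith
      then have "T m m = 0"
      proof
        assume "l \<notin> spins l'"
        then show ?thesis
          using diag[OF top_spins[OF l], of m] m m' mm wignerD_top_nonzero(2)[OF l m a a] by simp
      next
        assume "l' \<notin> spins l"
        then show ?thesis
          using diag[OF m top_spins[OF l']] m m' mm wignerD_top_nonzero(1)[OF l' _ a a, of m] by simp
      qed
      then show ?thesis using False mm by simp
    qed
  qed (use off m m' in simp)
qed

text \<open>Schur's lemma is used on the left indices with the right ones frozen, then on the right
  ones. There the sum runs over the row index of the Wigner matrix; passing to the adjoint matrix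
  and conjugating B brings it into the form of the left relation.\<close>

lemma wignerD_schur_two_sided:
  assumes l: "l \<in> half_nats" and l': "l' \<in> half_nats"
    and left: "\<And>g m s m' s'. g \<in> SU2 \<Longrightarrow> m \<in> spins l \<Longrightarrow> s \<in> spins l \<Longrightarrow> m' \<in> spins l' \<Longrightarrow> s' \<in> spins l' \<Longrightarrow>
      B m s m' s' = (\<Sum>p\<in>spins l. \<Sum>p'\<in>spins l'. wignerD l m p g * cnj (wignerD l' m' p' g) * B p s p' s')"
    and right: "\<And>g m s m' s'. g \<in> SU2 \<Longrightarrow> m \<in> spins l \<Longrightarrow> s \<in> spins l \<Longrightarrow> m' \<in> spins l' \<Longrightarrow> s' \<in> spins l' \<Longrightarrow>
      B m s m' s' = (\<Sum>q\<in>spins l. \<Sum>q'\<in>spins l'. wignerD l q s g * cnj (wignerD l' q' s' g) * B m q m' q')"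
    and m: "m \<in> spins l" and s: "s \<in> spins l" and m': "m' \<in> spins l'" and s': "s' \<in> spins l'"
  shows "B m s m' s' = of_bool (l = l' \<and> m = m' \<and> s = s') * B l l l l"
proof -
  have 1: "B m s m' s' = of_bool (l = l' \<and> m = m') * B l s l s'"
    by (rule wignerD_schur[OF l l', of "\<lambda>m m'. B m s m' s'"]) (use left m m' s s' in auto)
  show ?thesis
  proof (cases "l = l' \<and> m = m'")
    case True
    have top: "l \<in> spins l" by (rule top_spins[OF l])
    have "cnj (B l s l s') = of_bool (l = l \<and> s = s') * cnj (B l l l l)"
    proof (rule wignerD_schur[OF l l, of "\<lambda>s s'. cnj (B l s l s')"])
      fix g s s' assume g: "g \<in> SU2" and s: "s \<in> spins l" and s': "s' \<in> spins l"
      obtain \<alpha> \<beta> where gh: "g = h \<alpha> \<beta>" and 2: "norm (\<alpha>, \<beta>) = 1"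
        using g by (rule SU2E)
      have "h (cnj \<alpha>) (- \<beta>) \<in> SU2" using 2 by (simp add: h_in_SU2_iff norm_prod_def)
      from right[OF this top s, of l s'] True top s' have "B l s l s' = (\<Sum>q\<in>spins l. \<Sum>q'\<in>spins l.
         wignerD l q s (h (cnj \<alpha>) (- \<beta>)) * cnj (wignerD l q' s' (h (cnj \<alpha>) (- \<beta>))) * B l q l q')" by simp
      then show "cnj (B l s l s') = (\<Sum>q\<in>spins l. \<Sum>q'\<in>spins l.
         wignerD l s q g * cnj (wignerD l s' q' g) * cnj (B l q l q'))"
        using s s' by (simp add: gh wignerD_adjoint[OF l _ _, of _ _ \<alpha> \<beta>] mult_ac cong: sum.cong)
    qed (use True s s' in auto)
    then have "B l s l s' = of_bool (s = s') * B l l l l"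
      by (cases "s = s'") simp_all
    then show ?thesis using 1 True by simp
  qed (use 1 in auto)
qed

section \<open>Coefficients of invariant fields\<close>

lemma borel_measurable_cnj [measurable (raw)]:
  "f \<in> borel_measurable M \<Longrightarrow> (\<lambda>x. cnj (f x)) \<in> borel_measurable M"
  by (erule measurable_compose) (intro borel_measurable_continuous_onI continuous_intros)

lemma integral_sum_sum:
  fixes f :: "'i \<Rightarrow> 'j \<Rightarrow> 'b \<Rightarrow> complex"
  assumes "\<And>i j. i \<in> I \<Longrightarrow> j \<in> J \<Longrightarrow> integrable P (f i j)"
  shows "(LINT x|P. (\<Sum>i\<in>I. \<Sum>j\<in>J. c i j * f i j x)) = (\<Sum>i\<in>I. \<Sum>j\<in>J. c i j * integral\<^sup>L P (f i j))"
  using assms by simp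

lemma wignerD_measurable_vol:
  "l \<in> half_nats \<Longrightarrow> m \<in> spins l \<Longrightarrow> s \<in> spins l \<Longrightarrow> wignerD l m s \<in> borel_measurable vol_SU2"
  unfolding measurable_cong_sets[OF sets_vol_SU2 refl]
  by (intro measurable_restrict_space1 wignerD_measurable)

lemma phi_measurable:
  "l \<in> half_nats \<Longrightarrow> m \<in> spins l \<Longrightarrow> s \<in> spins l \<Longrightarrow> phi l m s \<in> borel_measurable vol_SU2"
  unfolding phi_def[abs_def] by (intro borel_measurable_times borel_measurable_const wignerD_measurable_vol)

lemma cmod_phi_le:
  assumes "l \<in> half_nats" "m \<in> spins l" "s \<in> spins l" "g \<in> SU2"
  shows "cmod (phi l m s g) \<le> \<bar>sqrt (2 * l + 1) / (4 * pi)\<bar>"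
  unfolding phi_def norm_mult norm_of_real
  by (rule mult_left_le[OF cmod_wignerD_le[OF assms] abs_ge_zero])

lemma phi_mult_left:
  assumes "l \<in> half_nats" "m \<in> spins l" "s \<in> spins l" "k \<in> SU2" "g \<in> SU2"
  shows "phi l m s (k ** g) = (\<Sum>p\<in>spins l. wignerD l m p k * phi l p s g)"
  unfolding phi_def wignerD_mult[OF assms] sum_distrib_left by (simp add: mult_ac)

lemma phi_mult_right:
  assumes "l \<in> half_nats" "m \<in> spins l" "s \<in> spins l" "g \<in> SU2" "k \<in> SU2"
  shows "phi l m s (g ** k) = (\<Sum>q\<in>spins l. phi l m q g * wignerD l q s k)"
  unfolding phi_def wignerD_mult[OF assms] sum_distrib_left by (simp add: mult_ac)

lemma phi_uminus:
  assumes "l \<in> half_nats" "m \<in> spins l" "s \<in> spins l" "g \<in> SU2"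
  shows "phi l (- m) (- s) g = (- 1) ^ nat \<lfloor>l - m\<rfloor> * (- 1) ^ nat \<lfloor>l - s\<rfloor> * cnj (phi l m s g)"
  unfolding phi_def cnj_wignerD[OF assms] by (simp add: mult_ac)

text \<open>With \<open>\<pi> = \<pi>'\<close> the identity and \<open>K = 1\<close> this gives the orthogonality of the Wigner functions,
  with \<open>\<pi>, \<pi>'\<close> the projections of a product and \<open>K\<close> a covariance kernel the decorrelation of the
  coefficients.\<close>

lemma bi_invariant_schur:
  fixes K :: "'b \<Rightarrow> complex"
  assumes P: "finite_measure P"
    and \<pi>: "\<pi> \<in> measurable P vol_SU2" "\<pi>' \<in> measurable P vol_SU2"
    and K: "K \<in> borel_measurable P" "\<And>x. x \<in> space P \<Longrightarrow> cmod (K x) \<le> C"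
    and \<tau>: "\<And>k k'. k \<in> SU2 \<Longrightarrow> k' \<in> SU2 \<Longrightarrow> \<exists>\<tau>\<in>measurable P P. distr P P \<tau> = P \<and>
      (\<forall>x\<in>space P. \<pi> (\<tau> x) = k ** \<pi> x ** k' \<and> \<pi>' (\<tau> x) = k ** \<pi>' x ** k' \<and> K (\<tau> x) = K x)"
    and l: "l \<in> half_nats" and l': "l' \<in> half_nats"
    and m: "m \<in> spins l" and s: "s \<in> spins l" and m': "m' \<in> spins l'" and s': "s' \<in> spins l'"
  shows "(LINT x|P. phi l m s (\<pi> x) * cnj (phi l' m' s' (\<pi>' x)) * K x) =
    of_bool (l = l' \<and> m = m' \<and> s = s') * (LINT x|P. phi l l l (\<pi> x) * cnj (phi l' l l (\<pi>' x)) * K x)"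
proof -
  interpret finite_measure P by fact
  note [measurable] = \<pi> K(1)
  define f where "f m s m' s' x = phi l m s (\<pi> x) * cnj (phi l' m' s' (\<pi>' x)) * K x" for m s m' s' x
  have f_meas: "f m s m' s' \<in> borel_measurable P"
    if "m \<in> spins l" "s \<in> spins l" "m' \<in> spins l'" "s' \<in> spins l'" for m s m' s'
  proof -
    note [measurable] = phi_measurable[OF l that(1,2)] phi_measurable[OF l' that(3,4)]
    show ?thesis unfolding f_def[abs_def] by measurable
  qed
  have f_int: "integrable P (f m s m' s')"
    if "m \<in> spins l" "s \<in> spins l" "m' \<in> spins l'" "s' \<in> spins l'" for m s m' s'
  proof (rule integrable_const_bound)
    show "AE x in P. cmod (f m s m' s' x) \<le>
        \<bar>sqrt (2 * l + 1) / (4 * pi)\<bar> * \<bar>sqrt (2 * l' + 1) / (4 * pi)\<bar> * C"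
    proof (rule AE_I2)
      fix x assume x: "x \<in> space P"
      then have "\<pi> x \<in> SU2" "\<pi>' x \<in> SU2"
        using measurable_space[OF \<pi>(1)] measurable_space[OF \<pi>(2)] by simp_all
      then show "cmod (f m s m' s' x) \<le>
          \<bar>sqrt (2 * l + 1) / (4 * pi)\<bar> * \<bar>sqrt (2 * l' + 1) / (4 * pi)\<bar> * C"
        unfolding f_def norm_mult complex_mod_cnj using K(2)[OF x]
        by (intro mult_mono cmod_phi_le l l' that mult_nonneg_nonneg abs_ge_zero norm_ge_zero)
    qed
  qed (rule f_meas[OF that])
  define B where "B m s m' s' = integral\<^sup>L P (f m s m' s')" for m s m' s'
  \<comment> \<open>Change of variables along a measure-preserving map that translates both points
    and fixes K.\<close>
  have shift: "B m s m' s' = (LINT x|P. phi l m s (k ** \<pi> x ** k') * cnj (phi l' m' s' (k ** \<pi>' x ** k')) * K x)"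
    if k: "k \<in> SU2" "k' \<in> SU2" and *: "m \<in> spins l" "s \<in> spins l" "m' \<in> spins l'" "s' \<in> spins l'" for k k' m s m' s'
  proof -
    obtain t where t: "t \<in> measurable P P" "distr P P t = P" "\<And>x. x \<in> space P \<Longrightarrow>
      \<pi> (t x) = k ** \<pi> x ** k' \<and> \<pi>' (t x) = k ** \<pi>' x ** k' \<and> K (t x) = K x"
      using \<tau>[OF k] by blast
    have "B m s m' s' = integral\<^sup>L (distr P P t) (f m s m' s')" by (simp add: B_def t(2))
    also have "\<dots> = (LINT x|P. f m s m' s' (t x))" by (rule integral_distr[OF t(1) f_meas[OF *]])
    finally show ?thesis by (simp add: f_def t(3) cong: Bochner_Integration.integral_cong)
  qed
  have "B m s m' s' = of_bool (l = l' \<and> m = m' \<and> s = s') * B l l l l"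
  proof (rule wignerD_schur_two_sided[OF l l'])
    fix k m s m' s'
    assume k: "k \<in> SU2" and *: "m \<in> spins l" "s \<in> spins l" "m' \<in> spins l'" "s' \<in> spins l'"
    have "B m s m' s' = (LINT x|P. (\<Sum>p\<in>spins l. \<Sum>p'\<in>spins l'. wignerD l m p k * cnj (wignerD l' m' p' k) * f p s p' s' x))"
      unfolding shift[OF k mat_1_SU2 *]
    proof (rule Bochner_Integration.integral_cong[OF refl])
      fix x assume "x \<in> space P"
      then have "\<pi> x \<in> SU2" "\<pi>' x \<in> SU2"
        using measurable_space[OF \<pi>(1)] measurable_space[OF \<pi>(2)] by simp_all
      then show "phi l m s (k ** \<pi> x ** mat 1) * cnj (phi l' m' s' (k ** \<pi>' x ** mat 1)) * K x =
          (\<Sum>p\<in>spins l. \<Sum>p'\<in>spins l'. wignerD l m p k * cnj (wignerD l' m' p' k) * f p s p' s' x)"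
        by (simp only: matrix_mul_rid phi_mult_left[OF l *(1,2) k] phi_mult_left[OF l' *(3,4) k] cnj_sum complex_cnj_mult)
           (simp only: sum_product, simp only: sum_distrib_right, simp only: f_def mult_ac)
    qed
    also have "\<dots> = (\<Sum>p\<in>spins l. \<Sum>p'\<in>spins l'. wignerD l m p k * cnj (wignerD l' m' p' k) * B p s p' s')"
      unfolding B_def by (rule integral_sum_sum) (use f_int * in blast)
    finally show "B m s m' s' = (\<Sum>p\<in>spins l. \<Sum>p'\<in>spins l'. wignerD l m p k * cnj (wignerD l' m' p' k) * B p s p' s')" .
  next
    fix k m s m' s'
    assume k: "k \<in> SU2" and *: "m \<in> spins l" "s \<in> spins l" "m' \<in> spins l'" "s' \<in> spins l'"
    have "B m s m' s' = (LINT x|P. (\<Sum>q\<in>spins l. \<Sum>q'\<in>spins l'. wignerD l q s k * cnj (wignerD l' q' s' k) * f m q m' q' x))"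
      unfolding shift[OF mat_1_SU2 k *]
    proof (rule Bochner_Integration.integral_cong[OF refl])
      fix x assume "x \<in> space P"
      then have "\<pi> x \<in> SU2" "\<pi>' x \<in> SU2"
        using measurable_space[OF \<pi>(1)] measurable_space[OF \<pi>(2)] by simp_all
      then show "phi l m s (mat 1 ** \<pi> x ** k) * cnj (phi l' m' s' (mat 1 ** \<pi>' x ** k)) * K x =
          (\<Sum>q\<in>spins l. \<Sum>q'\<in>spins l'. wignerD l q s k * cnj (wignerD l' q' s' k) * f m q m' q' x)"
        by (simp only: matrix_mul_lid phi_mult_right[OF l *(1,2) _ k] phi_mult_right[OF l' *(3,4) _ k] cnj_sum complex_cnj_mult)
           (simp only: sum_product, simp only: sum_distrib_right, simp only: f_def mult_ac)
    qed
    also have "\<dots> = (\<Sum>q\<in>spins l. \<Sum>q'\<in>spins l'. wignerD l q s k * cnj (wignerD l' q' s' k) * B m q m' q')"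
      unfolding B_def by (rule integral_sum_sum) (use f_int * in blast)
    finally show "B m s m' s' = (\<Sum>q\<in>spins l. \<Sum>q'\<in>spins l'. wignerD l q s k * cnj (wignerD l' q' s' k) * B m q m' q')" .
  qed fact+
  then show ?thesis unfolding B_def f_def[abs_def] .
qed

lemma measurable_translation_vol:
  assumes "k \<in> SU2" "k' \<in> SU2"
  shows "(\<lambda>g. k ** g ** k') \<in> measurable vol_SU2 vol_SU2"
  unfolding measurable_cong_sets[OF sets_vol_SU2 sets_vol_SU2] by (rule measurable_translation_SU2[OF assms])

section \<open>Orthonormality and Parseval's identity within one spin\<close>

text \<open>Schur's lemma leaves one common squared norm. Summed over a column, |phi|^2 is constant
  by unitarity, with value (2l+1)/(16 pi^2); integration over the volume 16 pi^2 gives 2l+1 for 2l+1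
  equal summands, so each is 1.\<close>

lemma phi_orthonormal:
  assumes l: "l \<in> half_nats" and "m \<in> spins l" "s \<in> spins l" "m' \<in> spins l" "s' \<in> spins l"
  shows "L2_inner (phi l m s) (phi l m' s') = of_bool (m = m' \<and> s = s')"
proof -
  interpret finite_measure vol_SU2 by (rule finite_measure_vol_SU2)
  have schur: "L2_inner (phi l m s) (phi l m' s') = of_bool (m = m' \<and> s = s') * L2_inner (phi l l l) (phi l l l)"
    if "m \<in> spins l" "s \<in> spins l" "m' \<in> spins l" "s' \<in> spins l" for m s m' s'
  proof -
    have "(LINT g|vol_SU2. phi l m' s' g * cnj (phi l m s g) * 1) =
      of_bool (l = l \<and> m' = m \<and> s' = s) * (LINT g|vol_SU2. phi l l l g * cnj (phi l l l g) * 1)"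
    proof (rule bi_invariant_schur[where C = 1])
      fix k k' assume k: "k \<in> SU2" "k' \<in> SU2"
      show "\<exists>\<tau>\<in>measurable vol_SU2 vol_SU2. distr vol_SU2 vol_SU2 \<tau> = vol_SU2 \<and>
        (\<forall>x\<in>space vol_SU2. \<tau> x = k ** x ** k' \<and> \<tau> x = k ** x ** k' \<and> (1 :: complex) = 1)"
        by (rule bexI[OF _ measurable_translation_vol[OF k]]) (simp add: vol_SU2_invariant[OF k])
    qed (use that l finite_measure_vol_SU2 in auto)
    then show ?thesis unfolding L2_inner_def by (auto simp: mult_ac)
  qed
  define c where "c = sqrt (2 * l + 1) / (4 * pi)"
  have l0: "0 \<le> l" using l by (auto elim: half_natsE)
  have top: "l \<in> spins l" by (rule top_spins[OF l])
  have int: "integrable vol_SU2 (\<lambda>g. cnj (phi l m l g) * phi l m l g)" if "m \<in> spins l" for m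
  proof (rule integrable_const_bound)
    note [measurable] = phi_measurable[OF l that top]
    show "(\<lambda>g. cnj (phi l m l g) * phi l m l g) \<in> borel_measurable vol_SU2" by measurable
    show "AE g in vol_SU2. norm (cnj (phi l m l g) * phi l m l g) \<le>
        \<bar>sqrt (2 * l + 1) / (4 * pi)\<bar> * \<bar>sqrt (2 * l + 1) / (4 * pi)\<bar>"
      by (rule AE_I2) (simp only: norm_mult complex_mod_cnj space_vol_SU2,
        intro mult_mono cmod_phi_le l that top norm_ge_zero abs_ge_zero)
  qed
  have diag: "L2_inner (phi l m l) (phi l m l) = L2_inner (phi l l l) (phi l l l)" if "m \<in> spins l" for m
    by (subst schur[OF that top that top]) simp
  have "complex_of_real (2 * l + 1) * L2_inner (phi l l l) (phi l l l) = (\<Sum>m\<in>spins l. L2_inner (phi l m l) (phi l m l))"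
    by (simp only: diag sum_constant card_spins[OF l, symmetric] of_real_of_nat_eq cong: sum.cong)
  also have "\<dots> = (LINT g|vol_SU2. (\<Sum>m\<in>spins l. cnj (phi l m l g) * phi l m l g))"
    unfolding L2_inner_def by (rule Bochner_Integration.integral_sum[symmetric]) (rule int)
  also have "\<dots> = (LINT g|vol_SU2. complex_of_real (c\<^sup>2))"
  proof (rule Bochner_Integration.integral_cong[OF refl])
    fix g assume "g \<in> space vol_SU2"
    then have g: "g \<in> SU2" by simp
    have "(\<Sum>m\<in>spins l. cnj (phi l m l g) * phi l m l g) =
        complex_of_real (c\<^sup>2) * (\<Sum>m\<in>spins l. cnj (wignerD l m l g) * wignerD l m l g)"
      unfolding phi_def c_def[symmetric] sum_distrib_left by (simp add: power2_eq_square mult_ac)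
    then show "(\<Sum>m\<in>spins l. cnj (phi l m l g) * phi l m l g) = complex_of_real (c\<^sup>2)"
      using wignerD_column_orthonormal[OF l top top g] by simp
  qed
  also have "\<dots> = complex_of_real (16 * pi\<^sup>2 * (c\<^sup>2))"
    by (simp add: measure_vol_SU2 scaleR_conv_of_real)
  also have "16 * pi\<^sup>2 * (c\<^sup>2) = 2 * l + 1"
    using l0 by (simp add: c_def power_divide power_mult_distrib)
  finally have "L2_inner (phi l l l) (phi l l l) = 1"
    using l0 by (simp del: of_real_add of_real_mult)
  then show ?thesis using schur assms by simp
qed

lemma L2_inner_phi_sums:
  assumes l: "l \<in> half_nats"
  shows "L2_inner (\<lambda>g. \<Sum>m\<in>spins l. \<Sum>s\<in>spins l. a m s * phi l m s g) (\<lambda>g. \<Sum>m\<in>spins l. \<Sum>s\<in>spins l. b m s * phi l m s g) =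
    (\<Sum>m\<in>spins l. \<Sum>s\<in>spins l. cnj (a m s) * b m s)"
proof -
  interpret finite_measure vol_SU2 by (rule finite_measure_vol_SU2)
  define S where "S = spins l \<times> spins l"
  define f where "f p = phi l (fst p) (snd p)" for p
  have S[simp]: "finite S" unfolding S_def using finite_spins[OF l] by simp
  have int: "integrable vol_SU2 (\<lambda>g. cnj (f p g) * f q g)" if "p \<in> S" "q \<in> S" for p q
  proof (rule integrable_const_bound)
    have p: "fst p \<in> spins l" "snd p \<in> spins l" and q: "fst q \<in> spins l" "snd q \<in> spins l"
      using that by (auto simp: S_def)
    note [measurable] = phi_measurable[OF l p] phi_measurable[OF l q]
    show "(\<lambda>g. cnj (f p g) * f q g) \<in> borel_measurable vol_SU2" unfolding f_def by measurable
    show "AE g in vol_SU2. norm (cnj (f p g) * f q g) \<le>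
        \<bar>sqrt (2 * l + 1) / (4 * pi)\<bar> * \<bar>sqrt (2 * l + 1) / (4 * pi)\<bar>"
      by (rule AE_I2) (simp only: norm_mult complex_mod_cnj space_vol_SU2 f_def,
        intro mult_mono cmod_phi_le l p q norm_ge_zero abs_ge_zero)
  qed
  have sum: "(\<Sum>m\<in>spins l. \<Sum>s\<in>spins l. c m s) = (\<Sum>p\<in>S. c (fst p) (snd p))" for c :: "real \<Rightarrow> real \<Rightarrow> complex"
    unfolding S_def by (simp add: sum.cartesian_product case_prod_unfold)
  have "L2_inner (\<lambda>g. \<Sum>m\<in>spins l. \<Sum>s\<in>spins l. a m s * phi l m s g) (\<lambda>g. \<Sum>m\<in>spins l. \<Sum>s\<in>spins l. b m s * phi l m s g) =
     (LINT g|vol_SU2. (\<Sum>p\<in>S. \<Sum>q\<in>S. (cnj (a (fst p) (snd p)) * b (fst q) (snd q)) * (cnj (f p g) * f q g)))"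
    unfolding sum L2_inner_def f_def[symmetric] cnj_sum sum_product
    by (intro Bochner_Integration.integral_cong refl sum.cong) simp
  also have "\<dots> = (\<Sum>p\<in>S. \<Sum>q\<in>S. (cnj (a (fst p) (snd p)) * b (fst q) (snd q)) * L2_inner (f p) (f q))"
    unfolding L2_inner_def by (rule integral_sum_sum) (rule int)
  also have "\<dots> = (\<Sum>p\<in>S. \<Sum>q\<in>S. if p = q then cnj (a (fst p) (snd p)) * b (fst p) (snd p) else 0)"
    by (intro sum.cong refl) (auto simp: f_def S_def phi_orthonormal[OF l])
  also have "\<dots> = (\<Sum>p\<in>S. cnj (a (fst p) (snd p)) * b (fst p) (snd p))" by simp
  finally show ?thesis unfolding sum .
qed

section \<open>Correlations between the coefficients of two fields\<close>

text \<open>A product of two coefficients is an integral over pairs of points. Exchanging it with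
  the expectation leaves the kernel K(g, g') = E(cnj (Y(g)) Z(g')), which simultaneous translations
  preserve, as \<open>bi_invariant_schur\<close> requires. The uniform bound C on the second moments
  bounds E|cnj Y Z| by 2C, which justifies the exchange on the finite product measure.\<close>

lemma coeff_field_cross_correlation:
  fixes Y Z :: "'w \<Rightarrow> complex^2^2 \<Rightarrow> complex"
  assumes "prob_space M"
    and Y: "(\<lambda>(\<omega>, g). Y \<omega> g) \<in> borel_measurable (M \<Otimes>\<^sub>M vol_SU2)"
    and Z: "(\<lambda>(\<omega>, g). Z \<omega> g) \<in> borel_measurable (M \<Otimes>\<^sub>M vol_SU2)"
    and Y2: "\<And>g. g \<in> SU2 \<Longrightarrow> integrable M (\<lambda>\<omega>. (cmod (Y \<omega> g))\<^sup>2)"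
      "\<And>g. g \<in> SU2 \<Longrightarrow> (LINT \<omega>|M. (cmod (Y \<omega> g))\<^sup>2) \<le> C"
    and Z2: "\<And>g. g \<in> SU2 \<Longrightarrow> integrable M (\<lambda>\<omega>. (cmod (Z \<omega> g))\<^sup>2)"
      "\<And>g. g \<in> SU2 \<Longrightarrow> (LINT \<omega>|M. (cmod (Z \<omega> g))\<^sup>2) \<le> C"
    and inv: "\<And>k k' g g'. k \<in> SU2 \<Longrightarrow> k' \<in> SU2 \<Longrightarrow> g \<in> SU2 \<Longrightarrow> g' \<in> SU2 \<Longrightarrow>
      (LINT \<omega>|M. cnj (Y \<omega> (k ** g ** k')) * Z \<omega> (k ** g' ** k')) = (LINT \<omega>|M. cnj (Y \<omega> g) * Z \<omega> g')"
    and l: "l \<in> half_nats" and l': "l' \<in> half_nats"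
    and m: "m \<in> spins l" and s: "s \<in> spins l" and m': "m' \<in> spins l'" and s': "s' \<in> spins l'"
  shows "integrable M (\<lambda>\<omega>. cnj (coeff_field Y l m s \<omega>) * coeff_field Z l' m' s' \<omega>)" (is ?A)
    and "(LINT \<omega>|M. cnj (coeff_field Y l m s \<omega>) * coeff_field Z l' m' s' \<omega>) =
      of_bool (l = l' \<and> m = m' \<and> s = s') * (LINT \<omega>|M. cnj (coeff_field Y l l l \<omega>) * coeff_field Z l l l \<omega>)" (is ?B)
proof -
  interpret M: prob_space M by fact
  interpret V: finite_measure vol_SU2 by (rule finite_measure_vol_SU2)
  interpret VV: pair_sigma_finite vol_SU2 vol_SU2 ..
  let ?P = "vol_SU2 \<Otimes>\<^sub>M vol_SU2"
  interpret P: finite_measure ?P by (rule finite_measure_pair_measure) (rule finite_measure_vol_SU2)+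
  interpret PM: pair_sigma_finite ?P M ..
  have [measurable]: "(\<lambda>x. Y (fst x) (snd x)) \<in> borel_measurable (M \<Otimes>\<^sub>M vol_SU2)"
    "(\<lambda>x. Z (fst x) (snd x)) \<in> borel_measurable (M \<Otimes>\<^sub>M vol_SU2)"
    using Y Z by (simp_all add: case_prod_unfold)
  have Ym: "(\<lambda>x. Y (a x) (b x)) \<in> borel_measurable N"
    if "a \<in> measurable N M" "b \<in> measurable N vol_SU2" for a b and N :: "'c measure"
    using measurable_compose[OF measurable_Pair[OF that] \<open>(\<lambda>x. Y (fst x) (snd x)) \<in> _\<close>] by simp
  have Zm: "(\<lambda>x. Z (a x) (b x)) \<in> borel_measurable N"
    if "a \<in> measurable N M" "b \<in> measurable N vol_SU2" for a b and N :: "'c measure"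
    using measurable_compose[OF measurable_Pair[OF that] \<open>(\<lambda>x. Z (fst x) (snd x)) \<in> _\<close>] by simp
  have sp: "fst p \<in> SU2" "snd p \<in> SU2" if "p \<in> space ?P" for p
    using that by (auto simp: space_pair_measure)
  have le: "cmod (cnj y * z) \<le> (cmod y)\<^sup>2 + (cmod z)\<^sup>2" for y z
  proof -
    have "0 \<le> (cmod y - cmod z)\<^sup>2" "0 \<le> cmod y * cmod z" by simp_all
    then have "cmod y * cmod z \<le> (cmod y)\<^sup>2 + (cmod z)\<^sup>2" unfolding power2_diff by linarith
    then show ?thesis by (simp add: norm_mult)
  qed
  define W where "W p \<omega> = cnj (Y \<omega> (fst p)) * Z \<omega> (snd p)" for p \<omega>
  define K where "K p = (LINT \<omega>|M. W p \<omega>)" for p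
  have Wm[measurable]: "(\<lambda>x. W (fst x) (snd x)) \<in> borel_measurable (?P \<Otimes>\<^sub>M M)"
    unfolding W_def by (intro borel_measurable_times borel_measurable_cnj Ym Zm) measurable
  have W1: "integrable M (W p)" "(LINT \<omega>|M. cmod (W p \<omega>)) \<le> C + C" if p: "p \<in> space ?P" for p
  proof -
    have bd: "integrable M (\<lambda>\<omega>. (cmod (Y \<omega> (fst p)))\<^sup>2 + (cmod (Z \<omega> (snd p)))\<^sup>2)"
      using sp[OF p] Y2(1) Z2(1) by auto
    have [measurable]: "W p \<in> borel_measurable M" unfolding W_def[abs_def]
      using sp[OF p] by (intro borel_measurable_times borel_measurable_cnj Ym Zm) auto
    show W: "integrable M (W p)"
      by (rule Bochner_Integration.integrable_bound[OF bd]) (use le in \<open>auto simp: W_def intro: order_trans[OF _ abs_ge_self]\<close>)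
    have "(LINT \<omega>|M. cmod (W p \<omega>)) \<le> (LINT \<omega>|M. (cmod (Y \<omega> (fst p)))\<^sup>2 + (cmod (Z \<omega> (snd p)))\<^sup>2)"
      by (rule integral_mono[OF integrable_norm[OF W] bd]) (use le in \<open>simp add: W_def\<close>)
    also have "\<dots> \<le> C + C" using sp[OF p] Y2 Z2 
      by (subst Bochner_Integration.integral_add) (simp_all only: add_mono)
    finally show "(LINT \<omega>|M. cmod (W p \<omega>)) \<le> C + C" .
  qed
  have K_le: "cmod (K p) \<le> C + C" if "p \<in> space ?P" for p
    unfolding K_def using W1(2)[OF that] integral_norm_bound[of M "W p"] by linarith
  have Km: "K \<in> borel_measurable ?P" unfolding K_def[abs_def]
    by (rule M.borel_measurable_lebesgue_integral) (simp add: case_prod_unfold)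
  \<comment> \<open>Stated for arbitrary indices because it also serves the highest indices on the
    right-hand side.\<close>
  have main: "integrable M (\<lambda>\<omega>. cnj (coeff_field Y l m s \<omega>) * coeff_field Z l' m' s' \<omega>) \<and>
     (LINT \<omega>|M. cnj (coeff_field Y l m s \<omega>) * coeff_field Z l' m' s' \<omega>) =
     (LINT p|?P. phi l m s (fst p) * cnj (phi l' m' s' (snd p)) * K p)"
    if l: "l \<in> half_nats" and l': "l' \<in> half_nats"
    and m: "m \<in> spins l" and s: "s \<in> spins l" and m': "m' \<in> spins l'" and s': "s' \<in> spins l'"
    for l l' m s m' s'
  proof -
    define G where "G p = phi l m s (fst p) * cnj (phi l' m' s' (snd p))" for p
    note [measurable] = phi_measurable[OF l m s] phi_measurable[OF l' m' s']
    have Gm[measurable]: "G \<in> borel_measurable ?P" unfolding G_def[abs_def] by measurable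
    define b where "b = \<bar>sqrt (2 * l + 1) / (4 * pi)\<bar> * \<bar>sqrt (2 * l' + 1) / (4 * pi)\<bar>"
    have G_le: "cmod (G p) \<le> b" if "p \<in> space ?P" for p
      unfolding G_def b_def norm_mult complex_mod_cnj
      using sp[OF that] by (intro mult_mono cmod_phi_le l l' m s m' s' norm_ge_zero abs_ge_zero)
    have b0: "0 \<le> b" by (simp add: b_def)
    have int: "integrable (?P \<Otimes>\<^sub>M M) (\<lambda>(p, \<omega>). G p * W p \<omega>)"
    proof (rule PM.Fubini_integrable)
      show meas: "(\<lambda>(p, \<omega>). G p * W p \<omega>) \<in> borel_measurable (?P \<Otimes>\<^sub>M M)"
        unfolding case_prod_unfold by measurable
      show "AE p in ?P. integrable M (\<lambda>\<omega>. case (p, \<omega>) of (p, \<omega>) \<Rightarrow> G p * W p \<omega>)"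
        using W1(1) by (intro AE_I2) simp
      show "integrable ?P (\<lambda>p. LINT \<omega>|M. norm (case (p, \<omega>) of (p, \<omega>) \<Rightarrow> G p * W p \<omega>))"
      proof (rule P.integrable_const_bound)
        show "(\<lambda>p. LINT \<omega>|M. norm (case (p, \<omega>) of (p, \<omega>) \<Rightarrow> G p * W p \<omega>)) \<in> borel_measurable ?P"
          by (rule M.borel_measurable_lebesgue_integral) (simp add: case_prod_unfold)
        show "AE p in ?P. norm (LINT \<omega>|M. norm (case (p, \<omega>) of (p, \<omega>) \<Rightarrow> G p * W p \<omega>)) \<le> b * (C + C)"
        proof (rule AE_I2)
          fix p assume p: "p \<in> space ?P"
          have "norm (LINT \<omega>|M. norm (case (p, \<omega>) of (p, \<omega>) \<Rightarrow> G p * W p \<omega>)) = cmod (G p) * (LINT \<omega>|M. cmod (W p \<omega>))"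
            by (simp add: norm_mult abs_mult integral_nonneg_AE)
          also have "\<dots> \<le> b * (C + C)"
            using G_le[OF p] W1(2)[OF p] b0 by (intro mult_mono) (simp_all add: integral_nonneg_AE)
          finally show "norm (LINT \<omega>|M. norm (case (p, \<omega>) of (p, \<omega>) \<Rightarrow> G p * W p \<omega>)) \<le> b * (C + C)" .
        qed
      qed
    qed
    \<comment> \<open>For almost every outcome the integrand is integrable over pairs of points;
      only there is the double integral split into a product.\<close>
    have eq: "AE \<omega> in M. (LINT p|?P. G p * W p \<omega>) = cnj (coeff_field Y l m s \<omega>) * coeff_field Z l' m' s' \<omega>"
      using PM.AE_integrable_snd[OF int]
    proof eventually_elim
      fix \<omega> assume "integrable ?P (\<lambda>p. G p * W p \<omega>)"
      from VV.integral_fst'[OF this]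
      have "(LINT p|?P. G p * W p \<omega>) = (LINT g|vol_SU2. LINT g'|vol_SU2.
          (phi l m s g * cnj (Y \<omega> g)) * (cnj (phi l' m' s' g') * Z \<omega> g'))"
        by (simp add: G_def W_def mult_ac)
      also have "\<dots> = (LINT g|vol_SU2. phi l m s g * cnj (Y \<omega> g)) * (LINT g'|vol_SU2. cnj (phi l' m' s' g') * Z \<omega> g')"
        by simp
      also have "(LINT g|vol_SU2. phi l m s g * cnj (Y \<omega> g)) = cnj (coeff_field Y l m s \<omega>)"
        unfolding coeff_field_def L2_inner_def by (subst Bochner_Integration.integral_cnj[symmetric]) simp
      finally show "(LINT p|?P. G p * W p \<omega>) = cnj (coeff_field Y l m s \<omega>) * coeff_field Z l' m' s' \<omega>"
        unfolding coeff_field_def L2_inner_def .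
    qed
    have cm[measurable]: "coeff_field Y l m s \<in> borel_measurable M" "coeff_field Z l' m' s' \<in> borel_measurable M"
      unfolding coeff_field_def[abs_def] L2_inner_def
      by (intro V.borel_measurable_lebesgue_integral; simp add: case_prod_unfold)+
    have int': "integrable M (\<lambda>\<omega>. LINT p|?P. G p * W p \<omega>)" by (rule PM.integrable_snd[OF int])
    have "integrable M (\<lambda>\<omega>. cnj (coeff_field Y l m s \<omega>) * coeff_field Z l' m' s' \<omega>)"
      using int' by (rule integrable_cong_AE_imp) (use eq in \<open>auto elim: eventually_mono\<close>)
    moreover have "(LINT \<omega>|M. cnj (coeff_field Y l m s \<omega>) * coeff_field Z l' m' s' \<omega>) = (LINT \<omega>|M. LINT p|?P. G p * W p \<omega>)"
      by (rule integral_cong_AE) (use eq borel_measurable_integrable[OF int'] in \<open>auto elim: eventually_mono\<close>)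
    moreover have "\<dots> = (LINT p|?P. LINT \<omega>|M. G p * W p \<omega>)" by (rule PM.Fubini_integral[OF int])
    moreover have "\<dots> = (LINT p|?P. G p * K p)" by (simp add: K_def)
    ultimately show ?thesis by (simp add: G_def)
  qed
  show ?A using main[OF l l' m s m' s'] by blast
  have "(LINT p|?P. phi l m s (fst p) * cnj (phi l' m' s' (snd p)) * K p) =
    of_bool (l = l' \<and> m = m' \<and> s = s') * (LINT p|?P. phi l l l (fst p) * cnj (phi l' l l (snd p)) * K p)"
  proof (rule bi_invariant_schur[OF P.finite_measure_axioms _ _ Km K_le])
    fix k k' assume k: "k \<in> SU2" "k' \<in> SU2"
    let ?t = "\<lambda>g. k ** g ** k'"
    note t[measurable] = measurable_translation_vol[OF k]
    have sf: "sigma_finite_measure (distr vol_SU2 vol_SU2 ?t)"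
      unfolding vol_SU2_invariant[OF k] by (rule V.sigma_finite_measure_axioms)
    show "\<exists>\<tau>\<in>measurable ?P ?P. distr ?P ?P \<tau> = ?P \<and> (\<forall>x\<in>space ?P. fst (\<tau> x) = k ** fst x ** k' \<and>
        snd (\<tau> x) = k ** snd x ** k' \<and> K (\<tau> x) = K x)"
    proof (intro bexI conjI ballI)
      show "distr ?P ?P (\<lambda>(x, y). (?t x, ?t y)) = ?P"
        using pair_measure_distr[OF t t sf] by (simp add: vol_SU2_invariant[OF k])
      show "(\<lambda>(x, y). (?t x, ?t y)) \<in> measurable ?P ?P" by measurable
      fix p assume p: "p \<in> space ?P"
      show "K (case p of (x, y) \<Rightarrow> (?t x, ?t y)) = K p"
        using inv[OF k sp[OF p]] by (simp add: K_def W_def case_prod_unfold)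
    qed (auto simp: case_prod_unfold)
  qed (use l l' m s m' s' in auto)
  \<comment> \<open>For l \<noteq> l' both sides are 0; otherwise the Schur scalar is the
    correlation at the highest indices.\<close>
  then show ?B
    using main[OF l l' m s m' s'] main[OF l l] top_spins[OF l] by (cases "l = l'") auto
qed

section \<open>Signs under conjugation, and quadratic forms of a component\<close>

text \<open>The sign relating \<open>phi\<close> at opposite indices to its conjugate. It is kept as
  two powers of -1 because l - m and l - s are natural numbers even when m and s are
  half-integers.\<close>

definition wsign :: "real \<Rightarrow> real \<Rightarrow> real \<Rightarrow> complex" where
  "wsign l m s = (- 1) ^ nat \<lfloor>l - m\<rfloor> * (- 1) ^ nat \<lfloor>l - s\<rfloor>"

lemma wsign_square: "wsign l m s * wsign l m s = 1"
  by (simp add: wsign_def mult_ac flip: power_mult_distrib)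

lemma cnj_wsign: "cnj (wsign l m s) = wsign l m s"
  by (simp add: wsign_def)

text \<open>Reversing one index changes its factor by (-1)^(2l), which may be -1; this happens
  twice, so the product is unchanged.\<close>

lemma wsign_uminus:
  assumes l: "l \<in> half_nats" and m: "m \<in> spins l" and s: "s \<in> spins l"
  shows "wsign l (- m) (- s) = wsign l m s"
proof -
  obtain N where N: "l = real N / 2" using l by (rule half_natsE)
  have *: "(- 1) ^ nat \<lfloor>l - - m\<rfloor> = (- 1) ^ N * (- 1 :: complex) ^ nat \<lfloor>l - m\<rfloor>" if m: "m \<in> spins l" for m
  proof -
    obtain k where k: "m = - (real N / 2) + real k" "k \<le> N" using m unfolding N spins_half by blast
    have "l - - m = real k" "l - m = real (N - k)" using k by (simp_all add: N of_nat_diff)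
    then have e: "nat \<lfloor>l - - m\<rfloor> = k" "nat \<lfloor>l - m\<rfloor> = N - k" by simp_all
    have "N = (N - k) + k" using k(2) by simp
    then have "(- 1 :: complex) ^ N * (- 1) ^ (N - k) = ((- 1) ^ (N - k) * (- 1) ^ (N - k)) * (- 1) ^ k"
      by (metis power_add mult.assoc mult.commute)
    then show ?thesis unfolding e by (simp flip: power_mult_distrib)
  qed
  have "(- 1 :: complex) ^ N * (- 1) ^ N = 1" by (simp flip: power_mult_distrib)
  then show ?thesis unfolding wsign_def *[OF m] *[OF s] by (simp add: mult_ac)
qed

lemma phi_conv_uminus:
  assumes "l \<in> half_nats" "m \<in> spins l" "s \<in> spins l" "g \<in> SU2"
  shows "cnj (phi l m s g) = wsign l m s * phi l (- m) (- s) g"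
  unfolding phi_uminus[OF assms] wsign_def[symmetric] mult.assoc[symmetric] wsign_square by simp

text \<open>Through this E(a a') becomes a correlation of the pair (cnj X, X) with the first two
  indices reversed, which is the origin of the deltas in -m and -s.\<close>

lemma coeff_field_cnj:
  assumes l: "l \<in> half_nats" and m: "m \<in> spins l" and s: "s \<in> spins l"
  shows "cnj (coeff_field (\<lambda>\<omega> g. cnj (X \<omega> g)) l (- m) (- s) \<omega>) = wsign l m s * coeff_field X l m s \<omega>"
proof -
  have "cnj (coeff_field (\<lambda>\<omega> g. cnj (X \<omega> g)) l (- m) (- s) \<omega>) =
      (LINT g|vol_SU2. phi l (- m) (- s) g * X \<omega> g)"
    unfolding coeff_field_def L2_inner_def by (subst Bochner_Integration.integral_cnj[symmetric]) simp
  also have "\<dots> = (LINT g|vol_SU2. wsign l m s * (cnj (phi l m s g) * X \<omega> g))"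
    by (rule Bochner_Integration.integral_cong) (simp_all add: phi_uminus[OF l m s] wsign_def)
  finally show ?thesis by (simp add: coeff_field_def L2_inner_def)
qed

lemma L2_norm_component:
  assumes "l \<in> half_nats"
  shows "complex_of_real ((L2_norm (component X l \<omega>))\<^sup>2) =
    (\<Sum>m\<in>spins l. \<Sum>s\<in>spins l. cnj (coeff_field X l m s \<omega>) * coeff_field X l m s \<omega>)"
proof -
  have "complex_of_real ((L2_norm (component X l \<omega>))\<^sup>2) = L2_inner (component X l \<omega>) (component X l \<omega>)"
    unfolding L2_norm_def L2_inner_def
    by (simp add: integral_nonneg_AE complex_norm_square mult.commute flip: integral_complex_of_real del: of_real_power)
  then show ?thesis unfolding component_def[abs_def] L2_inner_phi_sums[OF assms] .
qed

text \<open>Reversing the indices expands the conjugate component in the same functions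
  \<open>phi\<close>; Parseval's identity then pairs each coefficient with the one at opposite
  indices.\<close>

lemma L2_inner_cnj_component:
  assumes l: "l \<in> half_nats"
  shows "L2_inner (\<lambda>g. cnj (component X l \<omega> g)) (component X l \<omega>) =
    (\<Sum>m\<in>spins l. \<Sum>s\<in>spins l. wsign l m s * (coeff_field X l (- m) (- s) \<omega> * coeff_field X l m s \<omega>))"
proof -
  let ?a = "\<lambda>m s. coeff_field X l m s \<omega>"
  have "L2_inner (\<lambda>g. cnj (component X l \<omega> g)) (component X l \<omega>) =
    L2_inner (\<lambda>g. \<Sum>m\<in>spins l. \<Sum>s\<in>spins l. (wsign l m s * cnj (?a (- m) (- s))) * phi l m s g) (component X l \<omega>)"
    unfolding L2_inner_def
  proof (rule Bochner_Integration.integral_cong[OF refl])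
    fix g assume "g \<in> space vol_SU2"
    then have g: "g \<in> SU2" by simp
    have "cnj (component X l \<omega> g) = (\<Sum>m\<in>spins l. \<Sum>s\<in>spins l. cnj (?a m s) * (wsign l m s * phi l (- m) (- s) g))"
      unfolding component_def by (simp add: phi_conv_uminus[OF l _ _ g])
    also have "\<dots> = (\<Sum>m\<in>spins l. \<Sum>s\<in>spins l. cnj (?a (- m) (- s)) * (wsign l (- m) (- s) * phi l (- (- m)) (- (- s)) g))"
      by (subst sum_spins_uminus[OF l, symmetric], rule sum.cong[OF refl], rule sum_spins_uminus[OF l, symmetric])
    also have "\<dots> = (\<Sum>m\<in>spins l. \<Sum>s\<in>spins l. (wsign l m s * cnj (?a (- m) (- s))) * phi l m s g)"
      by (intro sum.cong refl) (simp add: wsign_uminus[OF l])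
    finally show "cnj (cnj (component X l \<omega> g)) * component X l \<omega> g =
       cnj (\<Sum>m\<in>spins l. \<Sum>s\<in>spins l. (wsign l m s * cnj (?a (- m) (- s))) * phi l m s g) * component X l \<omega> g"
      by (rule arg_cong)
  qed
  then show ?thesis unfolding component_def[abs_def] L2_inner_phi_sums[OF l] by (simp add: cnj_wsign mult.assoc)
qed

section \<open>Means, correlations and variances of the coefficients\<close>

theorem theorem65:
  fixes M :: "'w measure" and X :: "'w \<Rightarrow> complex^2^2 \<Rightarrow> complex"
  assumes "random_field M X" and "two_weakly_bi_invariant M X"
  shows
    "(\<forall>l\<in>half_nats. \<forall>m\<in>spins l. \<forall>s\<in>spins l.
        integrable M (coeff_field X l m s) \<and>
        (l \<noteq> 0 \<longrightarrow> (LINT \<omega>|M. coeff_field X l m s \<omega>) = 0)) \<and>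
     (\<forall>l\<in>half_nats.
        integrable M (\<lambda>\<omega>. (L2_norm (component X l \<omega>))\<^sup>2) \<and>
        integrable M (\<lambda>\<omega>. L2_inner (\<lambda>g. cnj (component X l \<omega> g)) (component X l \<omega>))) \<and>
     (\<forall>l\<in>half_nats. \<forall>l'\<in>half_nats.
      \<forall>m\<in>spins l. \<forall>s\<in>spins l. \<forall>m'\<in>spins l'. \<forall>s'\<in>spins l'.
        integrable M (\<lambda>\<omega>. cnj (coeff_field X l m s \<omega>) * coeff_field X l' m' s' \<omega>) \<and>
        (LINT \<omega>|M. cnj (coeff_field X l m s \<omega>) * coeff_field X l' m' s' \<omega>) =
          of_bool (m = m') * (of_bool (l = l') / complex_of_real ((2 * l + 1)\<^sup>2)) * of_bool (s = s')
            * complex_of_real (LINT \<omega>|M. (L2_norm (component X l \<omega>))\<^sup>2)) \<and>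
     (\<forall>l\<in>half_nats. \<forall>m\<in>spins l. \<forall>s\<in>spins l. \<forall>m'\<in>spins l. \<forall>s'\<in>spins l.
        complex_variance M (coeff_field X l m s) = complex_variance M (coeff_field X l m' s')) \<and>
     (\<forall>l\<in>half_nats. \<forall>l'\<in>half_nats.
      \<forall>m\<in>spins l. \<forall>s\<in>spins l. \<forall>m'\<in>spins l'. \<forall>s'\<in>spins l'.
        integrable M (\<lambda>\<omega>. coeff_field X l m s \<omega> * coeff_field X l' m' s' \<omega>) \<and>
        (LINT \<omega>|M. coeff_field X l m s \<omega> * coeff_field X l' m' s' \<omega>) =
          of_bool (- m = m') * (of_bool (l = l') / complex_of_real ((2 * l + 1)\<^sup>2)) * of_bool (- s = s')
            * (- 1) ^ nat \<lfloor>l - m\<rfloor> * (- 1) ^ nat \<lfloor>l - s\<rfloor>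
            * (LINT \<omega>|M. L2_inner (\<lambda>g. cnj (component X l \<omega> g)) (component X l \<omega>)))"
proof -
  interpret M: prob_space M using assms(1) by (simp add: random_field_def)
  have sets: "sets (M \<Otimes>\<^sub>M vol_SU2) = sets (M \<Otimes>\<^sub>M restrict_space borel SU2)"
    by (rule sets_pair_measure_cong[OF refl sets_vol_SU2])
  have Xm: "(\<lambda>(\<omega>, g). X \<omega> g) \<in> borel_measurable (M \<Otimes>\<^sub>M vol_SU2)"
    using assms(1) unfolding random_field_def measurable_cong_sets[OF sets refl] by simp
  then have cXm: "(\<lambda>(\<omega>, g). cnj (X \<omega> g)) \<in> borel_measurable (M \<Otimes>\<^sub>M vol_SU2)"
    unfolding case_prod_unfold by (rule borel_measurable_cnj)
  have moments: "integrable M (\<lambda>\<omega>. (cnj ^^ i) (X \<omega> g) * (cnj ^^ j) (X \<omega> g'))"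
    if "i \<in> {0, 1}" "j \<in> {0, 1}" "g \<in> SU2" "g' \<in> SU2" for i j :: nat and g g'
    using assms(2) that unfolding two_weakly_bi_invariant_def by blast
  have mean_inv: "(LINT \<omega>|M. (cnj ^^ i) (X \<omega> (k ** g ** k'))) = (LINT \<omega>|M. (cnj ^^ i) (X \<omega> g))"
    if "i \<in> {0, 1}" "k \<in> SU2" "k' \<in> SU2" "g \<in> SU2" for i :: nat and k k' g
    using assms(2) that unfolding two_weakly_bi_invariant_def by blast
  have inv: "(LINT \<omega>|M. (cnj ^^ i) (X \<omega> (k ** g ** k')) * (cnj ^^ j) (X \<omega> (k ** g' ** k'))) =
      (LINT \<omega>|M. (cnj ^^ i) (X \<omega> g) * (cnj ^^ j) (X \<omega> g'))"
    if "i \<in> {0, 1}" "j \<in> {0, 1}" "k \<in> SU2" "k' \<in> SU2" "g \<in> SU2" "g' \<in> SU2" for i j :: nat and k k' g g'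
    using assms(2) that unfolding two_weakly_bi_invariant_def by blast
  have sq: "complex_of_real ((cmod z)\<^sup>2) = cnj z * z" for z
    by (simp add: complex_norm_square mult.commute del: of_real_power)
  have X2: "integrable M (\<lambda>\<omega>. (cmod (X \<omega> g))\<^sup>2)" if "g \<in> SU2" for g
  proof -
    have "integrable M (\<lambda>\<omega>. complex_of_real ((cmod (X \<omega> g))\<^sup>2))"
      using moments[of 1 0 g g] that by (simp add: sq del: of_real_power)
    then show ?thesis unfolding complex_of_real_integrable_eq .
  qed
  \<comment> \<open>\<open>C - 1\<close> is the common second moment of X. The added 1 makes C also
    a bound for the constant field 1, with which X is paired for the means.\<close>
  define C where "C = (LINT \<omega>|M. (cmod (X \<omega> (mat 1)))\<^sup>2) + 1"
  have XC: "(LINT \<omega>|M. (cmod (X \<omega> g))\<^sup>2) = C - 1" if "g \<in> SU2" for g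
  proof -
    have "complex_of_real (LINT \<omega>|M. (cmod (X \<omega> g))\<^sup>2) = complex_of_real (C - 1)"
      using inv[of 1 0 g "mat 1" "mat 1" "mat 1"] that mat_1_SU2
      by (simp add: C_def sq flip: integral_complex_of_real del: of_real_power)
    then show ?thesis by (simp only: of_real_eq_iff)
  qed
  have C1: "1 \<le> C" by (simp add: C_def)
  have EXX: "integrable M (\<lambda>\<omega>. cnj (coeff_field X l m s \<omega>) * coeff_field X l' m' s' \<omega>)"
    "(LINT \<omega>|M. cnj (coeff_field X l m s \<omega>) * coeff_field X l' m' s' \<omega>) =
      of_bool (l = l' \<and> m = m' \<and> s = s') * (LINT \<omega>|M. cnj (coeff_field X l l l \<omega>) * coeff_field X l l l \<omega>)"
    if "l \<in> half_nats" "l' \<in> half_nats" "m \<in> spins l" "s \<in> spins l" "m' \<in> spins l'" "s' \<in> spins l'" for l l' m s m' s'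
  proof -
    have "(LINT \<omega>|M. cnj (X \<omega> (k ** g ** k')) * X \<omega> (k ** g' ** k')) = (LINT \<omega>|M. cnj (X \<omega> g) * X \<omega> g')"
      if "k \<in> SU2" "k' \<in> SU2" "g \<in> SU2" "g' \<in> SU2" for k k' g g'
      using inv[of 1 0 k k' g g'] that by simp
    note * = coeff_field_cross_correlation[OF M.prob_space_axioms Xm Xm X2 _ X2 _ this that, of C]
    show "integrable M (\<lambda>\<omega>. cnj (coeff_field X l m s \<omega>) * coeff_field X l' m' s' \<omega>)"
      by (rule *(1)) (simp_all add: XC)
    show "(LINT \<omega>|M. cnj (coeff_field X l m s \<omega>) * coeff_field X l' m' s' \<omega>) =
      of_bool (l = l' \<and> m = m' \<and> s = s') * (LINT \<omega>|M. cnj (coeff_field X l l l \<omega>) * coeff_field X l l l \<omega>)"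
      by (rule *(2)) (simp_all add: XC)
  qed
  \<comment> \<open>The scalar of the second formula: the correlation of the pair (cnj X, X) at the
    highest indices.\<close>
  define d where "d l = (LINT \<omega>|M. cnj (coeff_field (\<lambda>\<omega> g. cnj (X \<omega> g)) l l l \<omega>) * coeff_field X l l l \<omega>)" for l
  have EcXX: "integrable M (\<lambda>\<omega>. coeff_field X l m s \<omega> * coeff_field X l' m' s' \<omega>)"
    "(LINT \<omega>|M. coeff_field X l m s \<omega> * coeff_field X l' m' s' \<omega>) =
      wsign l m s * (of_bool (l = l' \<and> - m = m' \<and> - s = s') * d l)"
    if l: "l \<in> half_nats" "l' \<in> half_nats" and ms: "m \<in> spins l" "s \<in> spins l" and ms': "m' \<in> spins l'" "s' \<in> spins l'" for l l' m s m' s'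
  proof -
    have 1: "(LINT \<omega>|M. cnj (cnj (X \<omega> (k ** g ** k'))) * X \<omega> (k ** g' ** k')) = (LINT \<omega>|M. cnj (cnj (X \<omega> g)) * X \<omega> g')"
      if "k \<in> SU2" "k' \<in> SU2" "g \<in> SU2" "g' \<in> SU2" for k k' g g'
      using inv[of 0 0 k k' g g'] that by simp
    have 2: "integrable M (\<lambda>\<omega>. (cmod (cnj (X \<omega> g)))\<^sup>2)" if "g \<in> SU2" for g using X2[OF that] by simp
    note * = coeff_field_cross_correlation[OF M.prob_space_axioms cXm Xm 2 _ X2 _ 1 l
        uminus_spins[OF l(1) ms(1)] uminus_spins[OF l(1) ms(2)] ms', of C]
    have eq: "coeff_field X l m s \<omega> = wsign l m s * cnj (coeff_field (\<lambda>\<omega> g. cnj (X \<omega> g)) l (- m) (- s) \<omega>)" for \<omega>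
      unfolding coeff_field_cnj[OF l(1) ms] mult.assoc[symmetric] wsign_square by simp
    have "integrable M (\<lambda>\<omega>. cnj (coeff_field (\<lambda>\<omega> g. cnj (X \<omega> g)) l (- m) (- s) \<omega>) * coeff_field X l' m' s' \<omega>)"
      by (rule *(1)) (simp_all add: XC)
    then show "integrable M (\<lambda>\<omega>. coeff_field X l m s \<omega> * coeff_field X l' m' s' \<omega>)"
      unfolding eq mult.assoc by (rule integrable_mult_right)
    have "(LINT \<omega>|M. cnj (coeff_field (\<lambda>\<omega> g. cnj (X \<omega> g)) l (- m) (- s) \<omega>) * coeff_field X l' m' s' \<omega>) =
        of_bool (l = l' \<and> - m = m' \<and> - s = s') * d l"
      unfolding d_def by (rule *(2)) (simp_all add: XC)
    then show "(LINT \<omega>|M. coeff_field X l m s \<omega> * coeff_field X l' m' s' \<omega>) =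
      wsign l m s * (of_bool (l = l' \<and> - m = m' \<and> - s = s') * d l)"
      unfolding eq mult.assoc by simp
  qed
  \<comment> \<open>The mean of a coefficient is, up to a factor, its correlation with the only coefficient
    of the constant field 1, which has spin 0.\<close>
  have mean: "integrable M (coeff_field X l m s)" "l \<noteq> 0 \<Longrightarrow> (LINT \<omega>|M. coeff_field X l m s \<omega>) = 0"
    if l: "l \<in> half_nats" and ms: "m \<in> spins l" "s \<in> spins l" for l m s
  proof -
    have 0: "(0::real) \<in> spins 0" by (simp add: spins_0)
    have "psi 0 0 z0 z1 = 1" for z0 z1 by (simp add: psi_def)
    then have "wignerD 0 0 0 (h \<alpha> \<beta>) = 1" for \<alpha> \<beta>
      using wignerD_eq[OF zero_half_nats 0, of 0 0 \<alpha> \<beta>] by (simp add: spins_0)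
    then have "phi 0 0 0 g = complex_of_real (1 / (4 * pi))" if "g \<in> SU2" for g
      using SU2_eq_h[OF that] by (metis (no_types, opaque_lifting) add_0 mult.right_neutral mult_zero_right phi_def real_sqrt_one)
    then have "coeff_field (\<lambda>\<omega> g. 1) 0 0 0 \<omega> = (LINT g|vol_SU2. complex_of_real (1 / (4 * pi)))" for \<omega>
      unfolding coeff_field_def L2_inner_def by (intro Bochner_Integration.integral_cong refl) simp
    \<comment> \<open>The volume 16 pi^2 times the constant value 1/(4 pi) of
      \<open>phi 0 0 0\<close>.\<close>
    then have c0: "coeff_field (\<lambda>\<omega> g. 1) 0 0 0 \<omega> = complex_of_real (4 * pi)" for \<omega> :: 'w
      by (simp add: measure_vol_SU2 scaleR_conv_of_real power2_eq_square)
    have 1: "(LINT \<omega>|M. cnj (X \<omega> (k ** g ** k')) * 1) = (LINT \<omega>|M. cnj (X \<omega> g) * 1)"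
      if "k \<in> SU2" "k' \<in> SU2" "g \<in> SU2" "g' \<in> SU2" for k k' g g'
      using mean_inv[of 1 k k' g] that by simp
    have 2: "(\<lambda>(\<omega>, g). 1 :: complex) \<in> borel_measurable (M \<Otimes>\<^sub>M vol_SU2)" by simp
    note * = coeff_field_cross_correlation[OF M.prob_space_axioms Xm 2 X2 _ _ _ 1 l zero_half_nats ms 0 0, of C, unfolded c0]
    have "integrable M (\<lambda>\<omega>. cnj (coeff_field X l m s \<omega>) * complex_of_real (4 * pi))"
      by (rule *(1)) (use C1 in \<open>simp_all add: XC M.prob_space\<close>)
    then have "integrable M (\<lambda>\<omega>. cnj (cnj (coeff_field X l m s \<omega>) * complex_of_real (4 * pi)) * complex_of_real (1 / (4 * pi)))"
      by - (rule integrable_mult_left, rule integrable_cnj)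
    moreover have "(\<lambda>\<omega>. cnj (cnj (coeff_field X l m s \<omega>) * complex_of_real (4 * pi)) * complex_of_real (1 / (4 * pi))) = coeff_field X l m s"
      by (rule ext) simp
    ultimately show "integrable M (coeff_field X l m s)" by (simp only:)
    assume "l \<noteq> 0"
    have "(LINT \<omega>|M. cnj (coeff_field X l m s \<omega>) * complex_of_real (4 * pi)) =
       of_bool (l = 0 \<and> m = 0 \<and> s = 0) * (LINT \<omega>|M. cnj (coeff_field X l l l \<omega>) * coeff_field (\<lambda>\<omega> g. 1) l l l \<omega>)"
      by (rule *(2)) (use C1 in \<open>simp_all add: XC M.prob_space\<close>)
    then show "(LINT \<omega>|M. coeff_field X l m s \<omega>) = 0" using \<open>l \<noteq> 0\<close> by simp
  qed
  have card: "complex_of_nat (card (spins l)) = complex_of_real (2 * l + 1)" if "l \<in> half_nats" for l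
    by (simp only: card_spins[OF that, symmetric] of_real_of_nat_eq)
  have l1: "complex_of_real (2 * l + 1) \<noteq> 0" if "l \<in> half_nats" for l
    using that by (auto elim!: half_natsE simp: of_real_eq_0_iff simp del: of_real_add)
  \<comment> \<open>All (2l+1)^2 coefficients of spin l have the same second absolute moment; this
    count is the denominator in the formulas.\<close>
  have norm: "integrable M (\<lambda>\<omega>. (L2_norm (component X l \<omega>))\<^sup>2)"
    "complex_of_real (LINT \<omega>|M. (L2_norm (component X l \<omega>))\<^sup>2) =
      complex_of_real ((2 * l + 1)\<^sup>2) * (LINT \<omega>|M. cnj (coeff_field X l l l \<omega>) * coeff_field X l l l \<omega>)"
    if l: "l \<in> half_nats" for l
  proof -
    have "integrable M (\<lambda>\<omega>. complex_of_real ((L2_norm (component X l \<omega>))\<^sup>2))"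
      unfolding L2_norm_component[OF l] using EXX(1)[OF l l] by auto
    then show "integrable M (\<lambda>\<omega>. (L2_norm (component X l \<omega>))\<^sup>2)" by (rule complex_of_real_integrable_eq[THEN iffD1])
    have "complex_of_real (LINT \<omega>|M. (L2_norm (component X l \<omega>))\<^sup>2) =
        (\<Sum>m\<in>spins l. \<Sum>s\<in>spins l. (LINT \<omega>|M. cnj (coeff_field X l m s \<omega>) * coeff_field X l m s \<omega>))"
      unfolding integral_complex_of_real[symmetric] L2_norm_component[OF l] using EXX(1)[OF l l] by simp
    also have "\<dots> = (\<Sum>m\<in>spins l. \<Sum>s\<in>spins l. (LINT \<omega>|M. cnj (coeff_field X l l l \<omega>) * coeff_field X l l l \<omega>))"
      by (intro sum.cong refl) (subst EXX(2)[OF l l], simp_all)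
    also have "\<dots> = complex_of_real ((2 * l + 1)\<^sup>2) * (LINT \<omega>|M. cnj (coeff_field X l l l \<omega>) * coeff_field X l l l \<omega>)"
      unfolding sum_constant card[OF l] of_real_power by (simp only: power2_eq_square mult.assoc)
    finally show "complex_of_real (LINT \<omega>|M. (L2_norm (component X l \<omega>))\<^sup>2) =
      complex_of_real ((2 * l + 1)\<^sup>2) * (LINT \<omega>|M. cnj (coeff_field X l l l \<omega>) * coeff_field X l l l \<omega>)" .
  qed
  have inner: "integrable M (\<lambda>\<omega>. L2_inner (\<lambda>g. cnj (component X l \<omega> g)) (component X l \<omega>))"
    "(LINT \<omega>|M. L2_inner (\<lambda>g. cnj (component X l \<omega> g)) (component X l \<omega>)) = complex_of_real ((2 * l + 1)\<^sup>2) * d l"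
    if l: "l \<in> half_nats" for l
  proof -
    have int: "integrable M (\<lambda>\<omega>. coeff_field X l (- m) (- s) \<omega> * coeff_field X l m s \<omega>)"
      if "m \<in> spins l" "s \<in> spins l" for m s
      using EcXX(1)[OF l l] that uminus_spins[OF l] by blast
    then show "integrable M (\<lambda>\<omega>. L2_inner (\<lambda>g. cnj (component X l \<omega> g)) (component X l \<omega>))"
      unfolding L2_inner_cnj_component[OF l] by auto
    have "(LINT \<omega>|M. L2_inner (\<lambda>g. cnj (component X l \<omega> g)) (component X l \<omega>)) =
        (\<Sum>m\<in>spins l. \<Sum>s\<in>spins l. wsign l m s * (LINT \<omega>|M. coeff_field X l (- m) (- s) \<omega> * coeff_field X l m s \<omega>))"
      unfolding L2_inner_cnj_component[OF l] by (rule integral_sum_sum) (rule int)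
    \<comment> \<open>The sign from expanding the conjugate component equals the sign of the
      correlation, so every summand is \<open>d l\<close> and no phase i^(2l) is left over. For l =
      1, m = s = 0 and a real field, E(a a) and E<cnj X^l, X^l> are both nonnegative, which a factor
      i^2 would forbid unless both vanish.\<close>
    also have "\<dots> = (\<Sum>m\<in>spins l. \<Sum>s\<in>spins l. d l)"
    proof (intro sum.cong refl)
      fix m s assume ms: "m \<in> spins l" "s \<in> spins l"
      show "wsign l m s * (LINT \<omega>|M. coeff_field X l (- m) (- s) \<omega> * coeff_field X l m s \<omega>) = d l"
        unfolding EcXX(2)[OF l l uminus_spins[OF l ms(1)] uminus_spins[OF l ms(2)] ms] wsign_uminus[OF l ms]
          mult.assoc[symmetric] wsign_square by simp
    qed
    also have "\<dots> = complex_of_real ((2 * l + 1)\<^sup>2) * d l"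
      unfolding sum_constant card[OF l] of_real_power by (simp only: power2_eq_square mult.assoc)
    finally show "(LINT \<omega>|M. L2_inner (\<lambda>g. cnj (component X l \<omega> g)) (component X l \<omega>)) = complex_of_real ((2 * l + 1)\<^sup>2) * d l" .
  qed
  have var: "complex_variance M (coeff_field X l m s) = complex_variance M (coeff_field X l m' s')"
    if l: "l \<in> half_nats" and "m \<in> spins l" "s \<in> spins l" "m' \<in> spins l" "s' \<in> spins l" for l m s m' s'
  \<comment> \<open>For l = 0 the mean need not vanish, but there is only one coefficient; otherwise
    the variance is the second absolute moment.\<close>
  proof (cases "l = 0")
    case True
    then show ?thesis using that by (simp add: spins_0)
  next
    case False
    have "complex_of_real (complex_variance M (coeff_field X l m s)) =
        (LINT \<omega>|M. cnj (coeff_field X l l l \<omega>) * coeff_field X l l l \<omega>)"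
      if ms: "m \<in> spins l" "s \<in> spins l" for m s
      unfolding complex_variance_def mean(2)[OF l ms False]
      using EXX(2)[OF l l ms ms] by (simp add: sq flip: integral_complex_of_real del: of_real_power)
    then show ?thesis using that by (metis of_real_eq_iff)
  qed
  show ?thesis
  proof (intro conjI ballI impI)
    fix l l' m s m' s'
    assume l: "l \<in> half_nats" and l': "l' \<in> half_nats" and ms: "m \<in> spins l" "s \<in> spins l" and ms': "m' \<in> spins l'" "s' \<in> spins l'"
    have l1': "complex_of_real ((2 * l + 1)\<^sup>2) \<noteq> 0" unfolding of_real_power by (rule power_not_zero[OF l1[OF l]])
    show "(LINT \<omega>|M. cnj (coeff_field X l m s \<omega>) * coeff_field X l' m' s' \<omega>) =
          of_bool (m = m') * (of_bool (l = l') / complex_of_real ((2 * l + 1)\<^sup>2)) * of_bool (s = s')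
            * complex_of_real (LINT \<omega>|M. (L2_norm (component X l \<omega>))\<^sup>2)"
      unfolding norm(2)[OF l] EXX(2)[OF l l' ms ms'] using l1' by (simp del: of_real_power)
    show "(LINT \<omega>|M. coeff_field X l m s \<omega> * coeff_field X l' m' s' \<omega>) =
          of_bool (- m = m') * (of_bool (l = l') / complex_of_real ((2 * l + 1)\<^sup>2)) * of_bool (- s = s')
            * (- 1) ^ nat \<lfloor>l - m\<rfloor> * (- 1) ^ nat \<lfloor>l - s\<rfloor>
            * (LINT \<omega>|M. L2_inner (\<lambda>g. cnj (component X l \<omega> g)) (component X l \<omega>))"
      unfolding inner(2)[OF l] EcXX(2)[OF l l' ms ms'] wsign_def using l1' by (simp del: of_real_power)
  qed (fact mean EXX(1) EcXX(1) norm(1) inner(1) var)+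
qed

end
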